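(* Let $E$ be the extraspecial group of order $27$ and exponent $3$, and let $Q$ be the quaternion group of order $8$. Define positive integers $m_1,m_2,\dots$ by $m_1=1$, $m_{2k}=3^{m_{2k-1}}$ and $m_{2k+1}=2^{m_{2k}-1}$ for $k\ge 1$, and put $E_i=E^{m_i}$ if $i$ is odd and $E_i=Q^{m_i}$ if $i$ is even. Then there is an infinite sequence of groups $G_1,G_2,G_3,\dots$ with $G_1=\mathrm{Sp}_2(\mathbf F_3)$ such that, for every $i\ge 1$, $G_i$ embeds in $\operatorname{Aut}(E_i)$ and $G_{i+1}=G_i\ltimes E_i$ is the corresponding semidirect product (with normal subgroup $E_i$). In other words, one can construct the iterated split extension (continuing indefinitely) $$\mathrm{Sp}_2(\mathbf F_3)\ltimes E\ltimes Q^3\ltimes E^4\ltimes Q^{81}\ltimes E^{2^{80}}\ltimes\cdots .$$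
   Context: For an extraspecial group $X$, $X^m$ denotes the central product of $m$ copies of $X$ (all centres identified), so $E^m$ is extraspecial of order $3^{2m+1}$ and exponent $3$, and $Q^m$ is extraspecial of order $2^{2m+1}$. In a semidirect product written $G\ltimes N$ the subgroup $N$ is normal; iterated products are bracketed from the left: $((G\ltimes N_1)\ltimes N_2)\ltimes\cdots$. *)

theory Defs
  imports "HOL-Analysis.Analysis" "HOL-Algebra.Algebra"
begin

definition group_center :: "('a, 'b) monoid_scheme \<Rightarrow> 'a set" where
  "group_center G = {z \<in> carrier G. \<forall>x\<in>carrier G. z \<otimes>\<^bsub>G\<^esub> x = x \<otimes>\<^bsub>G\<^esub> z}"

definition elementary_abelian :: "nat \<Rightarrow> ('a, 'b) monoid_scheme \<Rightarrow> bool" where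
  "elementary_abelian p G \<longleftrightarrow>
     comm_group G \<and> (\<forall>x\<in>carrier G. x [^]\<^bsub>G\<^esub> p = \<one>\<^bsub>G\<^esub>)"

(* In HOL-Algebra, order is the cardinality of the carrier, which is 0 if the
   carrier is infinite; so the groups below are finite. *)
definition extraspecial :: "nat \<Rightarrow> ('a, 'b) monoid_scheme \<Rightarrow> bool" where
  "extraspecial p G \<longleftrightarrow>
     Factorial_Ring.prime p \<and> group G \<and> (\<exists>n. order G = p ^ n) \<and>
     card (group_center G) = p \<and>
     elementary_abelian p (G Mod group_center G) \<and>
     order (G Mod group_center G) \<noteq> 1"

definition exponent :: "('a, 'b) monoid_scheme \<Rightarrow> nat" where
  "exponent G = Lcm (group.ord G ` carrier G)"

(* Hamilton's product; (a, b, c, d) stands for a + b i + c j + d k. *)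
fun hamilton_mult :: "int \<times> int \<times> int \<times> int \<Rightarrow> int \<times> int \<times> int \<times> int \<Rightarrow> int \<times> int \<times> int \<times> int" where
  "hamilton_mult (a, b, c, d) (a', b', c', d') =
     (a * a' - b * b' - c * c' - d * d',
      a * b' + b * a' + c * d' - d * c',
      a * c' - b * d' + c * a' + d * b',
      a * d' + b * c' - c * b' + d * a')"

definition quaternion_group :: "(int \<times> int \<times> int \<times> int) monoid" where
  "quaternion_group =
     \<lparr>carrier = {(1, 0, 0, 0), (- 1, 0, 0, 0), (0, 1, 0, 0), (0, - 1, 0, 0),
                 (0, 0, 1, 0), (0, 0, - 1, 0), (0, 0, 0, 1), (0, 0, 0, - 1)},
      mult = hamilton_mult, one = (1, 0, 0, 0)\<rparr>"

definition coord_embedding ::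
    "('a, 'b) monoid_scheme \<Rightarrow> nat \<Rightarrow> nat \<Rightarrow> 'a \<Rightarrow> nat \<Rightarrow> 'a" where
  "coord_embedding H m i x = (\<lambda>k\<in>{..<m}. if k = i then x else \<one>\<^bsub>H\<^esub>)"

(* The central product of m copies of H: the quotient of the direct power by the
   relations identifying, for each central z, its images in all the factors.
   The subgroup generated by these relations is central, hence normal. *)
definition central_power :: "('a, 'b) monoid_scheme \<Rightarrow> nat \<Rightarrow> (nat \<Rightarrow> 'a) set monoid" where
  "central_power H m =
     (let P = product_group {..<m} (\<lambda>_. H)
      in P Mod generate P
           {coord_embedding H m i z \<otimes>\<^bsub>P\<^esub> inv\<^bsub>P\<^esub> coord_embedding H m j z | i j z.
              i < m \<and> j < m \<and> z \<in> group_center H})"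

(* The semidirect product of G and N with N normal: the pair (g, n) stands for the
   product n g, where g acts by g x g^{-1} = phi g x. *)
definition semidirect_product ::
    "('g, 'b) monoid_scheme \<Rightarrow> ('g \<Rightarrow> 'n \<Rightarrow> 'n) \<Rightarrow> ('n, 'c) monoid_scheme \<Rightarrow> ('g \<times> 'n) monoid" where
  "semidirect_product G \<phi> N =
     \<lparr>carrier = carrier G \<times> carrier N,
      mult = (\<lambda>(g, n) (h, m). (g \<otimes>\<^bsub>G\<^esub> h, n \<otimes>\<^bsub>N\<^esub> \<phi> g m)),
      one = (\<one>\<^bsub>G\<^esub>, \<one>\<^bsub>N\<^esub>)\<rparr>"

definition symplectic_gram :: "'a::comm_ring_1 ^ 2 ^ 2" where
  "symplectic_gram = vector [vector [0, 1], vector [- 1, 0]]"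

(* The symplectic group of degree 2 over 'a. The numeral type 3 is the ring of integers
   modulo 3, so Sp2 :: (3 ^ 2 ^ 2) monoid is the symplectic group over the field with
   three elements. *)
definition Sp2 :: "('a::comm_ring_1 ^ 2 ^ 2) monoid" where
  "Sp2 =
     \<lparr>carrier = {A. transpose A ** symplectic_gram ** A = symplectic_gram},
      mult = (**), one = mat 1\<rparr>"

end

theory Submission
  imports Defs "HOL-Library.Function_Algebras"
begin

text \<open>
  Both families of groups are Heisenberg groups of a form \<open>\<beta>\<close>: \<open>E\<^sup>m\<close> of the symplectic form on
  \<open>F\<^sub>3\<^sup>2\<^sup>m\<close>, and \<open>Q\<^sup>m\<close> of the hermitian form on \<open>F\<^sub>4\<^sup>m\<close>, with the cocycle \<open>\<psi> \<circ> \<beta>\<close>, \<open>\<psi>\<close> being a character with values in \<open>F\<^sub>4\<^sup>*\<close> and \<open>F\<^sub>3\<^sup>*\<close> respectively. In this model isometries of \<open>\<beta>\<close> act by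
  automorphisms. The Heisenberg group acts irreducibly, by operators \<open>\<rho> v\<close>, on a tensor power over
  the \<^emph>\<open>other\<close> field, and an isometry \<open>g\<close> acts there by the Weil operator
  \<open>T g = (\<Sum>w. \<psi> (\<beta> (g w) (g w - w)) \<rho> (w - g w))\<close>. The usual scalar ambiguity of the Weil
  representation disappears: comparing \<open>T g \<circ> T h\<close> with \<open>T (g \<circ> h)\<close> leaves a sum over triples
  of vectors that is invariant under a scalar of order \<open>2\<close> (for \<open>F\<^sub>3\<close>) or \<open>3\<close> (for \<open>F\<^sub>4\<close>), and this
  order is exactly the characteristic of the field containing the coefficients. So the semidirect
  product acts faithfully and isometrically on the tensor power, which is the space of the next
  stage: \<open>F\<^sub>4\<^sup>n\<close> with \<open>n = 3\<^sup>m\<close>, or, for odd \<open>m\<close>, a symplectic space of dimension \<open>2\<^sup>m\<close> over \<open>F\<^sub>3\<close>.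
\<close>

section \<open>Weil operators\<close>

text \<open>The recursion closes because the output of one stage meets the hypotheses of the next.
  The operators \<open>T g\<close> and \<open>\<rho> v\<close> are linear over the coefficient ring,
  so they commute with its scalars, and a scalar (\<open>\<omega>\<close> over F_4, -1 over F_3) is
  the \<open>\<tau>\<close> of the next stage. This is why commutation with \<open>\<tau>\<close> is
  carried along as part of \<open>isometry\<close>. No normalising factor is needed:
  \<open>V\<close> has 9^m or 4^m elements, which is 1 in the coefficient ring of characteristic 2
  or 3 respectively. Hence averages over \<open>V\<close> need no division, and the Weil sum of the
  identity is the identity. The exponents in the theorem count factors: F_4^n with n = 3^m is a sum
  of n hermitian lines, each giving one copy of Q, and a symplectic space of dimension 2^m is a sum
  of 2^(m-1) hyperbolic planes, each giving one copy of E. The tensor power of the alternating form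
  is alternating only for an odd exponent; the exponent in question is always a power of 3.\<close>

definition isometry ::
    "'v::ab_group_add set \<Rightarrow> ('v \<Rightarrow> 'v \<Rightarrow> 'c) \<Rightarrow> ('v \<Rightarrow> 'v) \<Rightarrow> ('v \<Rightarrow> 'v) \<Rightarrow> bool" where
  "isometry V \<beta> \<tau> g \<longleftrightarrow>
     (\<forall>v\<in>V. g v \<in> V \<and> g (\<tau> v) = \<tau> (g v)) \<and>
     (\<forall>v\<in>V. \<forall>w\<in>V. g (v + w) = g v + g w \<and> \<beta> (g v) (g w) = \<beta> v w)"

section \<open>Cancellation over free cyclic orbits\<close>

lemma funpow_mod_period:
  assumes "(f ^^ q) x = x"
  shows "(f ^^ n) x = (f ^^ (n mod q)) x"
proof -
  have *: "((f ^^ q) ^^ k) x = x" for k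
    by (induction k) (simp_all add: assms)
  have "(f ^^ n) x = (f ^^ (n mod q + q * (n div q))) x"
    by simp
  also have "\<dots> = (f ^^ (n mod q)) x"
    unfolding funpow_add comp_def funpow_mult[symmetric] by (simp add: *)
  finally show ?thesis .
qed

text \<open>Each orbit has exactly \<open>q\<close> points, on which \<open>F\<close> is constant,
  so it contributes \<open>of_nat q\<close> times a value. Orbits are removed one at a time by
  induction on the set.\<close>

lemma sum_free_cyclic_eq_0:
  fixes F :: "'a \<Rightarrow> 'b::comm_ring_1"
  assumes "finite S" and "\<And>t. t \<in> S \<Longrightarrow> \<tau> t \<in> S" and "\<And>t. t \<in> S \<Longrightarrow> F (\<tau> t) = F t"
    and "\<And>t. t \<in> S \<Longrightarrow> (\<tau> ^^ q) t = t"
    and "\<And>t j. t \<in> S \<Longrightarrow> 0 < j \<Longrightarrow> j < q \<Longrightarrow> (\<tau> ^^ j) t \<noteq> t"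
    and "0 < q" and "of_nat q = (0::'b)"
  shows "sum F S = 0"
  using assms(1-5)
proof (induction S rule: finite_psubset_induct)
  case (psubset S)
  show ?case
  proof (cases "S = {}")
    case False
    then obtain t where t: "t \<in> S" by blast
    let ?O = "(\<lambda>j. (\<tau> ^^ j) t) ` {..<q}"
    have inS: "(\<tau> ^^ j) t \<in> S" for j
      by (induction j) (simp_all add: t psubset.prems(1))
    have Fj: "F ((\<tau> ^^ j) t) = F t" for j
      by (induction j) (simp_all add: psubset.prems(2) inS)
    have inj: "inj_on (\<lambda>j. (\<tau> ^^ j) t) {..<q}"
    proof (rule linorder_inj_onI)
      fix i j :: nat
      assume "i < j" "i \<in> {..<q}" "j \<in> {..<q}"
      then show "(\<tau> ^^ i) t \<noteq> (\<tau> ^^ j) t"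
        using psubset.prems(4)[OF inS[of i], of "j - i"]
        by (metis (no_types, lifting) comp_apply funpow_add le_add_diff_inverse2 less_imp_le
            lessThan_iff less_imp_diff_less zero_less_diff)
    qed auto
    have Osub: "?O \<subseteq> S" using inS by blast
    \<comment> \<open>The complement of the orbit is again stable: \<open>\<tau> ^^ (q - 1)\<close>
      inverts \<open>\<tau>\<close>, so a point mapped into the orbit already lies in it.\<close>
    have inv: "\<tau> s \<in> S - ?O" if s: "s \<in> S - ?O" for s
    proof (rule ccontr)
      assume "\<tau> s \<notin> S - ?O"
      then obtain j where j: "\<tau> s = (\<tau> ^^ j) t"
        using s psubset.prems(1) by blast
      have "s = (\<tau> ^^ (q - 1)) (\<tau> s)"
        using psubset.prems(3)[of s] s \<open>0 < q\<close>
        by (metis DiffD1 Suc_diff_1 comp_apply funpow_Suc_right)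
      also have "\<dots> = (\<tau> ^^ (q - 1 + j)) t"
        by (simp add: j funpow_add)
      also have "\<dots> = (\<tau> ^^ ((q - 1 + j) mod q)) t"
        by (rule funpow_mod_period) (simp add: psubset.prems(3) t)
      also have "\<dots> \<in> ?O"
        using \<open>0 < q\<close> by (intro imageI) simp
      finally show False using s by blast
    qed
    have "t \<in> ?O"
      using \<open>0 < q\<close> by (intro image_eqI[of _ _ 0]) auto
    then have "S - ?O \<subset> S"
      using t by blast
    then have rest: "sum F (S - ?O) = 0"
      by (rule psubset.IH) (use inv psubset.prems in auto)
    have "sum F ?O = (\<Sum>j<q. F t)"
      by (simp add: sum.reindex[OF inj] Fj)
    also have "\<dots> = 0"
      by (simp add: assms(7))
    finally have "sum F ?O = 0" .
    moreover have "sum F S = sum F (S - ?O) + sum F ?O"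
      using Osub \<open>finite S\<close> by (rule sum.subset_diff)
    ultimately show ?thesis using rest by simp
  qed simp
qed

text \<open>\<open>V\<close> is a set and not a type, since its dimension changes from stage to
  stage. Nondegeneracy is asked of the commutator \<open>\<psi> (\<beta> v w - \<beta> w v)\<close>
  of the Heisenberg group, because the hermitian form is not alternating.\<close>

locale bicharacter =
  fixes V :: "'v::ab_group_add set"
    and \<beta> :: "'v \<Rightarrow> 'v \<Rightarrow> 'c::{ab_group_add, finite}"
    and \<psi> :: "'c \<Rightarrow> 'f::comm_ring_1"
  assumes beta_add_left: "\<beta> (u + v) w = \<beta> u w + \<beta> v w"
    and beta_add_right: "\<beta> u (v + w) = \<beta> u v + \<beta> u w"
    and psi_add: "\<psi> (a + b) = \<psi> a * \<psi> b"
    and psi_0 [simp]: "\<psi> 0 = 1"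
    and finite_V [simp]: "finite V"
    and V_0 [simp]: "0 \<in> V"
    and V_diff: "v \<in> V \<Longrightarrow> w \<in> V \<Longrightarrow> v - w \<in> V"
    and nondegenerate: "v \<in> V \<Longrightarrow> (\<And>w. w \<in> V \<Longrightarrow> \<psi> (\<beta> v w - \<beta> w v) = 1) \<Longrightarrow> v = 0"
begin

sublocale beta_left: Modules.additive "\<lambda>u. \<beta> u w" for w
  by standard (rule beta_add_left)
sublocale beta_right: Modules.additive "\<beta> u" for u
  by standard (rule beta_add_right)

lemmas beta_simps = beta_add_left beta_add_right beta_left.diff beta_right.diff
  beta_left.minus beta_right.minus

lemma V_add: "v \<in> V \<Longrightarrow> w \<in> V \<Longrightarrow> v + w \<in> V"
  using V_diff[of v "- w"] V_diff[OF V_0, of w] by simp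

lemma V_minus: "v \<in> V \<Longrightarrow> - v \<in> V"
  using V_diff[OF V_0, of v] by simp

lemma psi_minus_mult [simp]: "\<psi> (- a) * \<psi> a = 1" "\<psi> a * \<psi> (- a) = 1"
  using psi_add[of "- a" a] psi_add[of a "- a"] by simp_all

lemma psi_diff: "\<psi> (a - b) = \<psi> a * \<psi> (- b)"
  using psi_add[of a "- b"] by simp

end

text \<open>\<open>\<rho>\<close> is a projective representation with cocycle
  \<open>\<psi> (\<beta> v w)\<close>. It sends the whole type into \<open>M\<close>, and
  \<open>\<rho> 0\<close> is a projection onto \<open>M\<close>. \<open>tau_free\<close> gives every
  nonzero vector an orbit of full length \<open>q\<close>. By \<open>bar_psi\<close> the values of
  \<open>\<psi>\<close> have norm 1.\<close>

locale weil_module = bicharacter V \<beta> \<psi> + Modules.module scale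
  for V :: "'v::ab_group_add set"
    and \<beta> :: "'v \<Rightarrow> 'v \<Rightarrow> 'c::{ab_group_add, finite}"
    and \<psi> :: "'c \<Rightarrow> 'f::comm_ring_1"
    and scale :: "'f \<Rightarrow> 'm::ab_group_add \<Rightarrow> 'm" (infixr \<open>*s\<close> 75) +
  fixes \<tau> :: "'v \<Rightarrow> 'v"
    and q :: nat
    and M :: "'m set"
    and \<rho> :: "'v \<Rightarrow> 'm \<Rightarrow> 'm"
    and B :: "'m \<Rightarrow> 'm \<Rightarrow> 'f"
    and bar :: "'f \<Rightarrow> 'f"
  assumes no_zero_div: "\<And>a b :: 'f. a * b = 0 \<Longrightarrow> a = 0 \<or> b = 0"
    and card_V: "of_nat (card V) = (1::'f)"
    and tau_add: "\<tau> (v + w) = \<tau> v + \<tau> w"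
    and tau_V: "v \<in> V \<Longrightarrow> \<tau> v \<in> V"
    and tau_isometry: "\<beta> (\<tau> v) (\<tau> w) = \<beta> v w"
    and tau_order: "v \<in> V \<Longrightarrow> (\<tau> ^^ q) v = v"
    and tau_free: "v \<in> V \<Longrightarrow> 0 < j \<Longrightarrow> j < q \<Longrightarrow> (\<tau> ^^ j) v = v \<Longrightarrow> v = 0"
    and q_pos: "0 < q"
    and q_0: "of_nat q = (0::'f)"
    and rho_add: "\<rho> v (x + y) = \<rho> v x + \<rho> v y"
    and rho_scale: "\<rho> v (c *s x) = c *s \<rho> v x"
    and rho_rho: "\<rho> v (\<rho> w x) = \<psi> (\<beta> v w) *s \<rho> (v + w) x"
    and rho_M: "\<rho> v x \<in> M"
    and rho_0: "x \<in> M \<Longrightarrow> \<rho> 0 x = x"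
    and M_0: "0 \<in> M"
    and M_add: "x \<in> M \<Longrightarrow> y \<in> M \<Longrightarrow> x + y \<in> M"
    and M_scale: "x \<in> M \<Longrightarrow> c *s x \<in> M"
    and M_faithful: "(\<And>x. x \<in> M \<Longrightarrow> c *s x = d *s x) \<Longrightarrow> c = d"
    and B_add_left: "B (x + y) z = B x z + B y z"
    and B_add_right: "B x (y + z) = B x y + B x z"
    and B_scale_left: "B (c *s x) y = c * B x y"
    and B_scale_right: "B x (c *s y) = bar c * B x y"
    and bar_psi: "bar (\<psi> a) = \<psi> (- a)"
    and B_rho: "x \<in> M \<Longrightarrow> y \<in> M \<Longrightarrow> B (\<rho> v x) (\<rho> v y) = B x y"
begin

sublocale rho: Modules.additive "\<rho> v" for v
  by standard (rule rho_add)
sublocale B_left: Modules.additive "\<lambda>x. B x y" for y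
  by standard (rule B_add_left)
sublocale B_right: Modules.additive "B x" for x
  by standard (rule B_add_right)
sublocale tau: Modules.additive \<tau>
  by standard (rule tau_add)

lemma M_sum: "(\<And>i. i \<in> I \<Longrightarrow> f i \<in> M) \<Longrightarrow> sum f I \<in> M"
  by (induction I rule: infinite_finite_induct) (auto simp: M_0 M_add)

lemma rho_conj: "\<rho> u (\<rho> v (\<rho> (- u) x)) = \<psi> (- \<beta> u u) *s \<psi> (\<beta> u v - \<beta> v u) *s \<rho> v x"
  by (simp add: rho_rho rho_scale beta_simps psi_add[symmetric] algebra_simps)

text \<open>Orthogonality of characters: translating \<open>u\<close> by a vector \<open>w\<close>
  whose commutator with \<open>v\<close> is nontrivial multiplies the sum by
  \<open>c \<noteq> 1\<close>, and without zero divisors the sum is 0. For \<open>v = 0\<close> it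
  is the cardinality of \<open>V\<close>, that is 1.\<close>

lemma sum_psi_commutator:
  assumes "v \<in> V"
  shows "(\<Sum>u\<in>V. \<psi> (\<beta> u v - \<beta> v u)) = (if v = 0 then 1 else 0)"
proof (cases "v = 0")
  case True
  then show ?thesis by (simp add: beta_left.zero beta_right.zero card_V)
next
  case False
  let ?s = "\<Sum>u\<in>V. \<psi> (\<beta> u v - \<beta> v u)"
  obtain w where w: "w \<in> V" "\<psi> (\<beta> v w - \<beta> w v) \<noteq> 1"
    using nondegenerate[OF assms] False by blast
  define c where "c = \<psi> (\<beta> (- w) v - \<beta> v (- w))"
  have c: "c \<noteq> 1"
    using w(2) by (simp add: c_def beta_simps)
  have "?s = (\<Sum>u\<in>V. \<psi> (\<beta> (u - w) v - \<beta> v (u - w)))"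
    by (rule sum.reindex_bij_witness[of _ "\<lambda>u. u - w" "\<lambda>u. u + w"])
       (auto simp: V_add V_diff w(1))
  also have "\<dots> = (\<Sum>u\<in>V. c * \<psi> (\<beta> u v - \<beta> v u))"
    by (simp add: c_def psi_add[symmetric] beta_simps algebra_simps)
  finally have "?s = c * ?s"
    unfolding sum_distrib_left .
  then have "(1 - c) * ?s = 0"
    by (simp only: left_diff_distrib mult_1 right_minus_eq)
  then show ?thesis
    using no_zero_div[of "1 - c" ?s] c False by simp
qed

text \<open>The intertwiner obtained by averaging: the sum over \<open>w\<close> of
  \<open>\<rho> (g w)\<close> composed with the inverse of \<open>\<rho> w\<close>, which is
  \<open>\<psi> (\<beta> w w)\<close> times \<open>\<rho> (- w)\<close>, written with
  \<open>- w\<close> in place of \<open>w\<close>.\<close>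

definition T :: "('v \<Rightarrow> 'v) \<Rightarrow> 'm \<Rightarrow> 'm" where
  "T g x = (\<Sum>w\<in>V. \<psi> (\<beta> (g w) (g w - w)) *s \<rho> (w - g w) x)"

lemma T_add: "T g (x + y) = T g x + T g y"
  by (simp add: T_def rho_add scale_right_distrib sum.distrib)

sublocale T: Modules.additive "T g" for g
  by standard (rule T_add)

lemma T_scale: "T g (c *s x) = c *s T g x"
  by (simp add: T_def rho_scale scale_sum_right mult.commute)

lemma T_M: "T g x \<in> M"
  by (simp add: T_def M_sum M_scale rho_M)

context
  fixes g
  assumes g: "isometry V \<beta> \<tau> g"
begin

lemma isometry_V: "v \<in> V \<Longrightarrow> g v \<in> V"
  and isometry_tau: "v \<in> V \<Longrightarrow> g (\<tau> v) = \<tau> (g v)"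
  and isometry_add: "v \<in> V \<Longrightarrow> w \<in> V \<Longrightarrow> g (v + w) = g v + g w"
  and isometry_beta: "v \<in> V \<Longrightarrow> w \<in> V \<Longrightarrow> \<beta> (g v) (g w) = \<beta> v w"
  using g by (simp_all add: isometry_def)

lemma isometry_0: "g 0 = 0"
  using isometry_add[of 0 0] by simp

text \<open>Composing the average with \<open>\<rho> (g u)\<close> only shifts the summation
  variable by \<open>u\<close>, and the phases match because \<open>g\<close> preserves
  \<open>\<beta>\<close>. Thus \<open>T g\<close> implements \<open>g\<close> on the Heisenberg
  group.\<close>

lemma T_rho:
  assumes u: "u \<in> V"
  shows "T g (\<rho> u x) = \<rho> (g u) (T g x)"
proof -
  have "\<rho> (g u) (T g x) =
      (\<Sum>w\<in>V. \<psi> (\<beta> (g w) (g w - w) + \<beta> (g u) (w - g w)) *s \<rho> (g u + (w - g w)) x)"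
    by (simp add: T_def rho.sum rho_scale rho_rho psi_add)
  also have "\<dots> = (\<Sum>w\<in>V. \<psi> (\<beta> (g w) (g w - w) + \<beta> (w - g w) u) *s \<rho> (w - g w + u) x)"
  proof (rule sum.reindex_bij_witness[of _ "\<lambda>w. w + u" "\<lambda>w. w - u"])
    fix w assume w: "w \<in> V"
    have w': "w - u \<in> V" using w u by (simp add: V_diff)
    have gw: "g (w - u) = g w - g u"
      using isometry_add[OF w' u] by simp
    show "\<psi> (\<beta> (g (w - u)) (g (w - u) - (w - u)) + \<beta> (w - u - g (w - u)) u) *s
          \<rho> (w - u - g (w - u) + u) x =
      \<psi> (\<beta> (g w) (g w - w) + \<beta> (g u) (w - g w)) *s \<rho> (g u + (w - g w)) x"
      using isometry_beta[OF w u] isometry_beta[OF u u] by (simp add: gw beta_simps algebra_simps)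
  qed (auto simp: u V_add V_diff)
  also have "\<dots> = T g (\<rho> u x)"
    by (simp add: T_def rho_rho psi_add)
  finally show ?thesis by simp
qed

end

text \<open>The product of the three operators commutes with every \<^term>\<open>\<rho> u\<close>, hence equals its
  average over conjugation by all \<^term>\<open>\<rho> u\<close>; averaging removes every \<^term>\<open>\<rho> v\<close> with
  \<^term>\<open>v \<noteq> 0\<close>. The remaining scalar is a sum over triples which the
  diagonal action of \<^term>\<open>\<tau>\<close> breaks into one fixed triple and orbits of length \<^term>\<open>q\<close>, and
  \<^term>\<open>q\<close> vanishes in the scalar ring.\<close>
lemma T_T_T:
  assumes g: "isometry V \<beta> \<tau> g" and h: "isometry V \<beta> \<tau> h" and k: "isometry V \<beta> \<tau> k"
    and ghk: "\<And>v. v \<in> V \<Longrightarrow> g (h (k v)) = v"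
    and x: "x \<in> M"
  shows "T g (T h (T k x)) = x"
proof -
  let ?S = "V \<times> V \<times> V"
  define s where "s = (\<lambda>(w, y, z). (w - g w) + (y - h y) + (z - k z))"
  define e where "e = (\<lambda>(w, y, z). \<beta> (g w) (g w - w) + \<beta> (h y) (h y - y) + \<beta> (k z) (k z - z)
      + \<beta> (w - g w) (y - h y + (z - k z)) + \<beta> (y - h y) (z - k z))"
  let ?K = "\<lambda>x. T g (T h (T k x))"
  have K: "?K x = (\<Sum>t\<in>?S. \<psi> (e t) *s \<rho> (s t) x)" for x
  proof -
    have "?K x = (\<Sum>w\<in>V. \<Sum>y\<in>V. \<Sum>z\<in>V. \<psi> (e (w, y, z)) *s \<rho> (s (w, y, z)) x)"
      by (simp add: T_def rho.sum rho_scale rho_rho scale_sum_right psi_add e_def s_def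
          algebra_simps)
    then show ?thesis
      by (simp add: sum.cartesian_product)
  qed
  have s_V: "s t \<in> V" if "t \<in> ?S" for t
    using that
    by (auto simp: s_def V_add V_diff isometry_V[OF g] isometry_V[OF h] isometry_V[OF k])
  have comm: "?K (\<rho> u x) = \<rho> u (?K x)" if "u \<in> V" for u x
    using that by (simp add: T_rho[OF k] T_rho[OF h] T_rho[OF g] isometry_V[OF k] isometry_V[OF h]
        ghk)
  \<comment> \<open>Averaging costs no factor, since \<open>card V\<close> is 1 in the coefficients.
    The phase \<open>\<psi> (\<beta> u u)\<close> in the next line turns \<open>\<rho> (- u)\<close>
    into the inverse of \<open>\<rho> u\<close>.\<close>
  have "?K x = (\<Sum>u\<in>V. ?K x)"
    by (simp add: card_V sum_constant_scale)
  also have "\<dots> = (\<Sum>u\<in>V. \<psi> (\<beta> u u) *s \<rho> u (?K (\<rho> (- u) x)))"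
    by (simp add: comm[symmetric] rho_rho beta_simps T_scale psi_add[symmetric] rho_0 x)
  also have "\<dots> = (\<Sum>u\<in>V. \<Sum>t\<in>?S. \<psi> (e t) *s \<psi> (\<beta> u (s t) - \<beta> (s t) u) *s \<rho> (s t) x)"
    by (simp add: K rho.sum rho_scale rho_conj scale_sum_right)
      (simp add: mult.assoc[symmetric] mult.left_commute psi_add[symmetric])
  also have "\<dots> = (\<Sum>t\<in>?S. \<Sum>u\<in>V. \<psi> (e t) *s \<psi> (\<beta> u (s t) - \<beta> (s t) u) *s \<rho> (s t) x)"
    by (rule sum.swap)
  also have "\<dots> = (\<Sum>t\<in>?S. \<psi> (e t) *s (if s t = 0 then 1 else 0) *s \<rho> (s t) x)"
  proof (intro sum.cong refl)
    fix t assume t: "t \<in> ?S"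
    have "(\<Sum>u\<in>V. \<psi> (e t) *s \<psi> (\<beta> u (s t) - \<beta> (s t) u) *s \<rho> (s t) x) =
        \<psi> (e t) *s (\<Sum>u\<in>V. \<psi> (\<beta> u (s t) - \<beta> (s t) u)) *s \<rho> (s t) x"
      by (simp only: scale_sum_right scale_sum_left)
    then show "(\<Sum>u\<in>V. \<psi> (e t) *s \<psi> (\<beta> u (s t) - \<beta> (s t) u) *s \<rho> (s t) x) =
        \<psi> (e t) *s (if s t = 0 then 1 else 0) *s \<rho> (s t) x"
      by (simp only: sum_psi_commutator[OF s_V[OF t]])
  qed
  also have "\<dots> = (\<Sum>t\<in>?S. if s t = 0 then \<psi> (e t) *s x else 0)"
    by (intro sum.cong refl) (simp add: rho_0 x)
  also have "\<dots> = (\<Sum>t\<in>{t\<in>?S. s t = 0}. \<psi> (e t)) *s x"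
    by (simp add: sum.inter_filter[symmetric] scale_sum_left)
  also have "(\<Sum>t\<in>{t\<in>?S. s t = 0}. \<psi> (e t)) = 1"
  proof -
    let ?Z = "{t\<in>?S. s t = 0} - {(0, 0, 0)}"
    let ?t = "\<lambda>(w, y, z). (\<tau> w, \<tau> y, \<tau> z)"
    have pow: "(?t ^^ j) (w, y, z) = ((\<tau> ^^ j) w, (\<tau> ^^ j) y, (\<tau> ^^ j) z)" for j w y z
      by (induction j) simp_all
    have tau0: "\<tau> v = 0 \<longleftrightarrow> v = 0" if "v \<in> V" for v
    proof
      assume v: "\<tau> v = 0"
      have *: "(\<tau> ^^ j) v = 0" if "0 < j" for j
        using that by (induction j rule: nat_induct_non_zero) (simp_all add: v tau.zero)
      show "v = 0"
        using tau_order[OF that] *[OF q_pos] by simp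
    qed (simp add: tau.zero)
    have "sum (\<lambda>t. \<psi> (e t)) ?Z = 0"
    proof (rule sum_free_cyclic_eq_0[where \<tau> = ?t and q = q])
      fix t assume t: "t \<in> ?Z"
      obtain w y z where [simp]: "t = (w, y, z)" by (cases t)
      from t have V: "w \<in> V" "y \<in> V" "z \<in> V" and nz: "\<not> (w = 0 \<and> y = 0 \<and> z = 0)"
        and st: "s (w, y, z) = 0" by auto
      \<comment> \<open>Here commutation of the isometries with \<open>\<tau>\<close> enters: it
        makes the total vector equivariant and the phase invariant.\<close>
      have "s (?t t) = \<tau> (s t)" "e (?t t) = e t"
        using V by (simp_all add: s_def e_def tau.diff[symmetric] tau_add[symmetric]
            isometry_tau[OF g] isometry_tau[OF h] isometry_tau[OF k] tau_isometry)
      then show "?t t \<in> ?Z" "\<psi> (e (?t t)) = \<psi> (e t)"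
        using V nz st by (auto simp: tau_V tau.zero tau0)
      show "(?t ^^ q) t = t"
        using V by (simp add: pow tau_order)
      show "(?t ^^ j) t \<noteq> t" if "0 < j" "j < q" for j
        using V nz tau_free[OF _ that] by (auto simp: pow)
    qed (auto simp: q_pos q_0)
    moreover have "s (0, 0, 0) = 0" "e (0, 0, 0) = 0"
      by (simp_all add: s_def e_def isometry_0[OF g] isometry_0[OF h] isometry_0[OF k]
          beta_left.zero)
    ultimately show ?thesis
      by (subst sum.remove[of _ "(0, 0, 0)"]) auto
  qed
  finally show ?thesis by simp
qed

lemma isometry_id: "isometry V \<beta> \<tau> (\<lambda>v. v)"
  by (simp add: isometry_def)

lemma T_id:
  assumes "\<And>v. v \<in> V \<Longrightarrow> g v = v" and "x \<in> M"
  shows "T g x = x"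
  using assms by (simp add: T_def beta_right.zero rho_0 sum_constant_scale card_V)

text \<open>With \<open>k\<close> inverse to \<open>gh\<close>, both \<open>T k (T gh x) = x\<close>
  and \<open>T g (T h (T k y)) = y\<close> are cases of three isometries with trivial product;
  taking \<open>y = T gh x\<close> cancels \<open>T k\<close>.\<close>

lemma T_T:
  assumes g: "isometry V \<beta> \<tau> g" and h: "isometry V \<beta> \<tau> h"
    and gh: "isometry V \<beta> \<tau> gh" and k: "isometry V \<beta> \<tau> k"
    and comp: "\<And>v. v \<in> V \<Longrightarrow> gh v = g (h v)"
    and inv: "\<And>v. v \<in> V \<Longrightarrow> gh (k v) = v" "\<And>v. v \<in> V \<Longrightarrow> k (gh v) = v"
    and x: "x \<in> M"
  shows "T g (T h x) = T gh x"
proof -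
  have "T k (T gh x) = T k (T gh (T (\<lambda>v. v) x))"
    by (simp only: T_id[OF refl x])
  also have "\<dots> = x"
    using inv(2) x by (rule T_T_T[OF k gh isometry_id])
  finally have "T g (T h x) = T g (T h (T k (T gh x)))"
    by simp
  also have "\<dots> = T gh x"
    by (rule T_T_T[OF g h k])
       (use inv(1) isometry_V[OF k] in \<open>simp_all add: T_M comp[symmetric]\<close>)
  finally show ?thesis .
qed

text \<open>As \<open>\<rho> v\<close> preserves \<open>B\<close>, its adjoint is its inverse;
  \<open>bar_psi\<close> accounts for the sign in the phase.\<close>

lemma B_rho_left:
  assumes "x \<in> M" "y \<in> M"
  shows "B (\<rho> v x) y = \<psi> (- \<beta> v v) * B x (\<rho> (- v) y)"
proof -
  have y: "y = \<rho> v (\<psi> (\<beta> v v) *s \<rho> (- v) y)"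
    by (simp add: rho_scale rho_rho rho_0 assms beta_simps psi_add[symmetric])
  have "B (\<rho> v x) y = B x (\<psi> (\<beta> v v) *s \<rho> (- v) y)"
    by (subst y) (rule B_rho, simp_all add: assms rho_M M_scale)
  then show ?thesis
    by (simp add: B_scale_right bar_psi)
qed

text \<open>The operator of the inverse isometry is the adjoint.\<close>
lemma B_T:
  assumes g: "isometry V \<beta> \<tau> g" and k: "isometry V \<beta> \<tau> k"
    and gk: "\<And>v. v \<in> V \<Longrightarrow> g (k v) = v" and kg: "\<And>v. v \<in> V \<Longrightarrow> k (g v) = v"
    and x: "x \<in> M" and y: "y \<in> M"
  shows "B (T g x) (T g y) = B x y"
proof -
  have adj: "B (T g x) z = B x (T k z)" if z: "z \<in> M" for z
  proof -
    have "B (T g x) z =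
        (\<Sum>w\<in>V. \<psi> (\<beta> (g w) (g w - w) - \<beta> (w - g w) (w - g w)) * B x (\<rho> (g w - w) z))"
      by (simp add: T_def B_left.sum B_scale_left B_rho_left x z psi_diff mult.assoc)
    also have "\<dots> = (\<Sum>w\<in>V. \<psi> (- \<beta> (k w) (k w - w)) * B x (\<rho> (w - k w) z))"
    proof (rule sum.reindex_bij_witness[of _ k g])
      fix w assume w: "w \<in> V"
      show "\<psi> (- \<beta> (k (g w)) (k (g w) - g w)) * B x (\<rho> (g w - k (g w)) z) =
          \<psi> (\<beta> (g w) (g w - w) - \<beta> (w - g w) (w - g w)) * B x (\<rho> (g w - w) z)"
        using isometry_beta[OF g w w] by (simp add: kg w beta_simps algebra_simps)
    qed (auto simp: gk kg isometry_V[OF g] isometry_V[OF k])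
    also have "\<dots> = B x (T k z)"
      by (simp add: T_def B_right.sum B_scale_right bar_psi)
    finally show ?thesis .
  qed
  have "T k (T g y) = T k (T g (T (\<lambda>v. v) y))"
    by (simp only: T_id[OF refl y])
  also have "\<dots> = y"
    using kg y by (rule T_T_T[OF k g isometry_id])
  finally show ?thesis
    by (simp add: adj T_M)
qed

end

section \<open>Heisenberg groups and semidirect products\<close>

text \<open>The central component stores the value of \<open>\<psi>\<close> and not of the form, so
  the centre has order 2 in the hermitian case although the form takes values in F_4.\<close>

definition heisenberg ::
    "'v::ab_group_add set \<Rightarrow> ('v \<Rightarrow> 'v \<Rightarrow> 'c) \<Rightarrow> ('c \<Rightarrow> 'f) \<Rightarrow> ('v \<times> 'f::comm_ring_1) monoid" where
  "heisenberg V \<beta> \<psi> =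
     \<lparr>carrier = V \<times> range \<psi>,
      mult = (\<lambda>(v, a) (w, b). (v + w, a * b * \<psi> (\<beta> v w))),
      one = (0, 1)\<rparr>"

lemma heisenberg_simps [simp]:
  "carrier (heisenberg V \<beta> \<psi>) = V \<times> range \<psi>"
  "(v, a) \<otimes>\<^bsub>heisenberg V \<beta> \<psi>\<^esub> (w, b) = (v + w, a * b * \<psi> (\<beta> v w))"
  "\<one>\<^bsub>heisenberg V \<beta> \<psi>\<^esub> = (0, 1)"
  by (simp_all add: heisenberg_def)

lemma semidirect_product_simps [simp]:
  "carrier (semidirect_product G \<phi> N) = carrier G \<times> carrier N"
  "(g, n) \<otimes>\<^bsub>semidirect_product G \<phi> N\<^esub> (h, m) = (g \<otimes>\<^bsub>G\<^esub> h, n \<otimes>\<^bsub>N\<^esub> \<phi> g m)"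
  "\<one>\<^bsub>semidirect_product G \<phi> N\<^esub> = (\<one>\<^bsub>G\<^esub>, \<one>\<^bsub>N\<^esub>)"
  by (simp_all add: semidirect_product_def)

definition acts_by_automorphisms ::
    "('g, 'b) monoid_scheme \<Rightarrow> ('g \<Rightarrow> 'n \<Rightarrow> 'n) \<Rightarrow> ('n, 'c) monoid_scheme \<Rightarrow> bool" where
  "acts_by_automorphisms G \<alpha> N \<longleftrightarrow>
     (\<forall>g\<in>carrier G. \<alpha> g \<in> hom N N) \<and>
     (\<forall>n\<in>carrier N. \<alpha> \<one>\<^bsub>G\<^esub> n = n) \<and>
     (\<forall>g\<in>carrier G. \<forall>h\<in>carrier G. \<forall>n\<in>carrier N. \<alpha> (g \<otimes>\<^bsub>G\<^esub> h) n = \<alpha> g (\<alpha> h n))"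

definition faithful_on :: "('g, 'b) monoid_scheme \<Rightarrow> ('g \<Rightarrow> 'n \<Rightarrow> 'n) \<Rightarrow> 'n set \<Rightarrow> bool" where
  "faithful_on G \<alpha> S \<longleftrightarrow>
     (\<forall>g\<in>carrier G. (\<forall>x\<in>S. \<alpha> g x = x) \<longrightarrow> g = \<one>\<^bsub>G\<^esub>)"

lemma semidirect_product_group:
  assumes "group G" "group N" and act: "acts_by_automorphisms G \<alpha> N"
  shows "group (semidirect_product G \<alpha> N)"
proof -
  interpret G: group G by fact
  interpret N: group N by fact
  have hom: "\<alpha> g \<in> hom N N" if "g \<in> carrier G" for g
    using act that by (simp add: acts_by_automorphisms_def)
  have closed: "\<alpha> g n \<in> carrier N" if "g \<in> carrier G" "n \<in> carrier N" for g n
    using hom[OF that(1)] that(2) by (rule hom_in_carrier)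
  have mult: "\<alpha> g (n \<otimes>\<^bsub>N\<^esub> m) = \<alpha> g n \<otimes>\<^bsub>N\<^esub> \<alpha> g m"
    if "g \<in> carrier G" "n \<in> carrier N" "m \<in> carrier N" for g n m
    using hom[OF that(1)] that(2,3) by (rule hom_mult)
  have one: "\<alpha> \<one>\<^bsub>G\<^esub> n = n" if "n \<in> carrier N" for n
    using act that by (simp add: acts_by_automorphisms_def)
  have comp: "\<alpha> (g \<otimes>\<^bsub>G\<^esub> h) n = \<alpha> g (\<alpha> h n)"
    if "g \<in> carrier G" "h \<in> carrier G" "n \<in> carrier N" for g h n
    using act that by (simp add: acts_by_automorphisms_def)
  show ?thesis
  proof (rule groupI)
    fix x assume "x \<in> carrier (semidirect_product G \<alpha> N)"
    then obtain g n where [simp]: "x = (g, n)" and g: "g \<in> carrier G" and n: "n \<in> carrier N"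
      by auto
    let ?g = "inv\<^bsub>G\<^esub> g"
    have "(?g, \<alpha> ?g (inv\<^bsub>N\<^esub> n)) \<otimes>\<^bsub>semidirect_product G \<alpha> N\<^esub> x = \<one>\<^bsub>semidirect_product G \<alpha> N\<^esub>"
      using g n
      by (simp add: mult[symmetric] hom_one[OF hom] G.l_inv N.l_inv assms)
    then show "\<exists>y\<in>carrier (semidirect_product G \<alpha> N).
        y \<otimes>\<^bsub>semidirect_product G \<alpha> N\<^esub> x = \<one>\<^bsub>semidirect_product G \<alpha> N\<^esub>"
      using g n by (intro bexI[of _ "(?g, \<alpha> ?g (inv\<^bsub>N\<^esub> n))"]) (auto intro: closed)
  next
    fix x y assume "x \<in> carrier (semidirect_product G \<alpha> N)" "y \<in> carrier (semidirect_product G \<alpha> N)"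
    then show "x \<otimes>\<^bsub>semidirect_product G \<alpha> N\<^esub> y \<in> carrier (semidirect_product G \<alpha> N)"
      by (auto simp: closed)
  next
    fix x y z
    assume "x \<in> carrier (semidirect_product G \<alpha> N)" "y \<in> carrier (semidirect_product G \<alpha> N)"
      "z \<in> carrier (semidirect_product G \<alpha> N)"
    then show "x \<otimes>\<^bsub>semidirect_product G \<alpha> N\<^esub> y \<otimes>\<^bsub>semidirect_product G \<alpha> N\<^esub> z =
        x \<otimes>\<^bsub>semidirect_product G \<alpha> N\<^esub> (y \<otimes>\<^bsub>semidirect_product G \<alpha> N\<^esub> z)"
      by (auto simp: mult comp closed G.m_assoc N.m_assoc)
  next
    fix x assume "x \<in> carrier (semidirect_product G \<alpha> N)"
    then show "\<one>\<^bsub>semidirect_product G \<alpha> N\<^esub> \<otimes>\<^bsub>semidirect_product G \<alpha> N\<^esub> x = x"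
      by (auto simp: one)
  qed simp
qed

text \<open>The action is built on the Heisenberg model \<open>N'\<close>, whereas an embedding into
  the automorphism group of \<open>N\<close> is wanted. Conjugation with \<open>\<eta>\<close>
  provides it and changes the semidirect product only by an isomorphism.\<close>

lemma acts_by_automorphisms_transfer:
  assumes "group G" "group N" and \<eta>: "\<eta> \<in> iso N N'"
    and act: "acts_by_automorphisms G \<alpha> N'" and faithful: "faithful_on G \<alpha> (carrier N')"
  shows "\<exists>\<phi>\<in>mon G (AutoGroup N). semidirect_product G \<alpha> N' \<cong> semidirect_product G \<phi> N"
proof -
  interpret G: group G by fact
  interpret N: group N by fact
  define \<theta> where "\<theta> = inv_into (carrier N) \<eta>"
  have \<theta>: "\<theta> \<in> iso N' N"
    unfolding \<theta>_def by (rule N.iso_set_sym[OF \<eta>])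
  have bij: "bij_betw \<eta> (carrier N) (carrier N')" and hom: "\<eta> \<in> hom N N'"
    using \<eta> by (auto simp: iso_def)
  have hom': "\<theta> \<in> hom N' N"
    using \<theta> by (auto simp: iso_def)
  have \<eta>\<theta>: "\<eta> (\<theta> y) = y" if "y \<in> carrier N'" for y
    using bij that unfolding \<theta>_def by (rule bij_betw_inv_into_right)
  have \<theta>\<eta>: "\<theta> (\<eta> x) = x" if "x \<in> carrier N" for x
    using bij that unfolding \<theta>_def by (rule bij_betw_inv_into_left)
  note closed = hom_in_carrier[OF hom] hom_in_carrier[OF hom']
  have \<alpha>_closed: "\<alpha> g n \<in> carrier N'" if "g \<in> carrier G" "n \<in> carrier N'" for g n
    using act that by (auto simp: acts_by_automorphisms_def intro: hom_in_carrier)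
  have \<alpha>_mult: "\<alpha> g (n \<otimes>\<^bsub>N'\<^esub> m) = \<alpha> g n \<otimes>\<^bsub>N'\<^esub> \<alpha> g m"
    if "g \<in> carrier G" "n \<in> carrier N'" "m \<in> carrier N'" for g n m
    using act that by (auto simp: acts_by_automorphisms_def intro: hom_mult)
  have \<alpha>_one: "\<alpha> \<one>\<^bsub>G\<^esub> n = n" if "n \<in> carrier N'" for n
    using act that by (simp add: acts_by_automorphisms_def)
  have \<alpha>_comp: "\<alpha> (g \<otimes>\<^bsub>G\<^esub> h) n = \<alpha> g (\<alpha> h n)"
    if "g \<in> carrier G" "h \<in> carrier G" "n \<in> carrier N'" for g h n
    using act that by (simp add: acts_by_automorphisms_def)
  \<comment> \<open>Elements of \<open>AutoGroup N\<close> are extensional functions, hence the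
    restriction.\<close>
  define \<phi> where "\<phi> g = restrict (\<lambda>x. \<theta> (\<alpha> g (\<eta> x))) (carrier N)" for g
  have \<phi>_closed: "\<phi> g x \<in> carrier N" if "g \<in> carrier G" "x \<in> carrier N" for g x
    using that by (simp add: \<phi>_def closed \<alpha>_closed)
  have \<phi>_comp: "\<phi> (g \<otimes>\<^bsub>G\<^esub> h) x = \<phi> g (\<phi> h x)" if "g \<in> carrier G" "h \<in> carrier G" "x \<in> carrier N" for g h x
    using that by (simp add: \<phi>_def closed \<alpha>_closed \<eta>\<theta> \<alpha>_comp)
  have \<phi>_one: "\<phi> \<one>\<^bsub>G\<^esub> x = x" if "x \<in> carrier N" for x
    using that by (simp add: \<phi>_def closed \<theta>\<eta> \<alpha>_one)
  have bij_\<phi>: "\<phi> g \<in> Bij (carrier N)" if g: "g \<in> carrier G" for g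
  proof -
    have "bij_betw (\<phi> g) (carrier N) (carrier N)"
      by (rule bij_betwI[of _ _ _ "\<phi> (inv\<^bsub>G\<^esub> g)"])
         (use g in \<open>auto simp: \<phi>_closed \<phi>_comp[symmetric] G.l_inv G.r_inv \<phi>_one\<close>)
    then show ?thesis
      by (simp add: Bij_def \<phi>_def)
  qed
  have auto_\<phi>: "\<phi> g \<in> auto N" if g: "g \<in> carrier G" for g
    unfolding auto_def
  proof (rule IntI[OF homI bij_\<phi>[OF g]])
    fix x y assume "x \<in> carrier N" "y \<in> carrier N"
    then show "\<phi> g (x \<otimes>\<^bsub>N\<^esub> y) = \<phi> g x \<otimes>\<^bsub>N\<^esub> \<phi> g y"
      using g by (simp add: \<phi>_def hom_mult[OF hom] hom_mult[OF hom'] closed \<alpha>_closed \<alpha>_mult)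
  qed (rule \<phi>_closed[OF g])
  have "\<phi> \<in> mon G (AutoGroup N)"
    unfolding mon_def
  proof (rule CollectI, rule conjI)
    show "\<phi> \<in> hom G (AutoGroup N)"
    proof (rule homI)
      fix g h assume gh: "g \<in> carrier G" "h \<in> carrier G"
      have "\<phi> (g \<otimes>\<^bsub>G\<^esub> h) = compose (carrier N) (\<phi> g) (\<phi> h)"
      proof
        fix x
        show "\<phi> (g \<otimes>\<^bsub>G\<^esub> h) x = compose (carrier N) (\<phi> g) (\<phi> h) x"
        proof (cases "x \<in> carrier N")
          case True
          then show ?thesis by (simp add: compose_def \<phi>_comp gh)
        next
          case False
          then show ?thesis by (simp add: compose_def \<phi>_def)
        qed
      qed
      then show "\<phi> (g \<otimes>\<^bsub>G\<^esub> h) = \<phi> g \<otimes>\<^bsub>AutoGroup N\<^esub> \<phi> h"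
        by (simp add: AutoGroup_def BijGroup_def bij_\<phi> gh)
    qed (simp add: AutoGroup_def auto_\<phi>)
    have "g = h" if gh: "g \<in> carrier G" "h \<in> carrier G" and eq: "\<phi> g = \<phi> h" for g h
    proof -
      have "\<alpha> (inv\<^bsub>G\<^esub> h \<otimes>\<^bsub>G\<^esub> g) n = n" if n: "n \<in> carrier N'" for n
      proof -
        have "\<phi> (inv\<^bsub>G\<^esub> h \<otimes>\<^bsub>G\<^esub> g) (\<theta> n) = \<phi> (inv\<^bsub>G\<^esub> h \<otimes>\<^bsub>G\<^esub> h) (\<theta> n)"
          using gh n by (simp only: \<phi>_comp G.inv_closed closed eq)
        then have "\<phi> (inv\<^bsub>G\<^esub> h \<otimes>\<^bsub>G\<^esub> g) (\<theta> n) = \<theta> n"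
          using gh n by (simp add: G.l_inv \<phi>_one closed)
        then have "\<eta> (\<theta> (\<alpha> (inv\<^bsub>G\<^esub> h \<otimes>\<^bsub>G\<^esub> g) n)) = \<eta> (\<theta> n)"
          using n by (simp add: \<phi>_def closed \<eta>\<theta>)
        then show ?thesis
          using gh n by (simp add: \<eta>\<theta> \<alpha>_closed)
      qed
      then have "inv\<^bsub>G\<^esub> h \<otimes>\<^bsub>G\<^esub> g = \<one>\<^bsub>G\<^esub>"
        using faithful gh by (simp add: faithful_on_def)
      then show ?thesis
        using gh by (metis G.inv_closed G.inv_equality G.inv_inv)
    qed
    then show "inj_on \<phi> (carrier G)"
      by (auto intro: inj_onI)
  qed
  moreover have "(\<lambda>(g, y). (g, \<theta> y)) \<in> iso (semidirect_product G \<alpha> N') (semidirect_product G \<phi> N)"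
    unfolding iso_def
  proof (rule CollectI, rule conjI)
    show "(\<lambda>(g, y). (g, \<theta> y)) \<in> hom (semidirect_product G \<alpha> N') (semidirect_product G \<phi> N)"
    proof (rule homI)
      fix a b
      assume "a \<in> carrier (semidirect_product G \<alpha> N')" "b \<in> carrier (semidirect_product G \<alpha> N')"
      then show "(case a \<otimes>\<^bsub>semidirect_product G \<alpha> N'\<^esub> b of (g, y) \<Rightarrow> (g, \<theta> y)) =
          (case a of (g, y) \<Rightarrow> (g, \<theta> y)) \<otimes>\<^bsub>semidirect_product G \<phi> N\<^esub> (case b of (g, y) \<Rightarrow> (g, \<theta> y))"
        by (auto simp: hom_mult[OF hom'] \<alpha>_closed \<phi>_def \<eta>\<theta> closed)
    qed (auto simp: closed)
    show "bij_betw (\<lambda>(g, y). (g, \<theta> y)) (carrier (semidirect_product G \<alpha> N'))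
        (carrier (semidirect_product G \<phi> N))"
      by (rule bij_betwI[of _ _ _ "\<lambda>(g, x). (g, \<eta> x)"]) (auto simp: closed \<eta>\<theta> \<theta>\<eta>)
  qed
  ultimately show ?thesis
    by (auto intro: is_isoI)
qed

text \<open>A semidirect product has a new type at every stage; a copy on an initial segment of the
  naturals keeps the whole sequence in one type.\<close>

lemma iso_nat_monoid:
  assumes "group S" "finite (carrier S)"
  shows "\<exists>G :: nat monoid. group G \<and> finite (carrier G) \<and> G \<cong> S"
proof -
  interpret S: group S by fact
  obtain f where f: "bij_betw f (carrier S) {0..<card (carrier S)}"
    using ex_bij_betw_finite_nat[OF assms(2)] by blast
  define f' where "f' = inv_into (carrier S) f"
  have f'f: "f' (f x) = x" if "x \<in> carrier S" for x
    using f that unfolding f'_def by (rule bij_betw_inv_into_left)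
  have ff': "f (f' i) = i" if "i < card (carrier S)" for i
    using f that unfolding f'_def by (simp add: bij_betw_inv_into_right)
  have f'_in: "f' i \<in> carrier S" if "i < card (carrier S)" for i
    using bij_betw_inv_into[OF f] that unfolding f'_def by (auto simp: bij_betw_def)
  have lt: "f x < card (carrier S)" if "x \<in> carrier S" for x
    using f that by (auto simp: bij_betw_def)
  define G where "G = \<lparr>carrier = {0..<card (carrier S)},
    mult = (\<lambda>i j. f (f' i \<otimes>\<^bsub>S\<^esub> f' j)), one = f \<one>\<^bsub>S\<^esub>\<rparr>"
  have iso: "f \<in> iso S G"
    using f by (auto simp: iso_def hom_def G_def f'f bij_betw_def)
  then have "S \<cong> G" by (rule is_isoI)
  have "monoid G"
    by (rule monoidI; unfold G_def; simp)
       (use lt in \<open>auto simp: f'f f'_in ff' S.m_assoc\<close>)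
  with \<open>S \<cong> G\<close> have "group G"
    by (rule S.iso_imp_group)
  moreover have "G \<cong> S"
    using \<open>S \<cong> G\<close> by (rule S.iso_sym)
  ultimately show ?thesis
    by (intro exI[of _ G]) (simp add: G_def)
qed

definition isometric_action ::
    "('g, 'b) monoid_scheme \<Rightarrow> 'v::ab_group_add set \<Rightarrow> ('v \<Rightarrow> 'v \<Rightarrow> 'c) \<Rightarrow> ('v \<Rightarrow> 'v) \<Rightarrow>
      ('g \<Rightarrow> 'v \<Rightarrow> 'v) \<Rightarrow> bool" where
  "isometric_action G V \<beta> \<tau> a \<longleftrightarrow>
     (\<forall>g\<in>carrier G. isometry V \<beta> \<tau> (a g)) \<and>
     (\<forall>v\<in>V. a \<one>\<^bsub>G\<^esub> v = v) \<and>
     (\<forall>g\<in>carrier G. \<forall>h\<in>carrier G. \<forall>v\<in>V. a (g \<otimes>\<^bsub>G\<^esub> h) v = a g (a h v)) \<and>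
     faithful_on G a V"

lemma isometric_action_iso:
  assumes "group G" "group H" "H \<cong> G" and act: "isometric_action G V \<beta> \<tau> a"
  shows "\<exists>a. isometric_action H V \<beta> \<tau> a"
proof -
  from \<open>H \<cong> G\<close> obtain f where f: "f \<in> iso H G"
    by (auto simp: is_iso_def)
  then have hom: "f \<in> hom H G" and inj: "inj_on f (carrier H)"
    by (auto simp: iso_def bij_betw_def)
  have one: "f \<one>\<^bsub>H\<^esub> = \<one>\<^bsub>G\<^esub>"
    using hom assms(2,1) by (rule hom_one)
  have "isometric_action H V \<beta> \<tau> (\<lambda>h. a (f h))"
    using act inj group.is_monoid[OF assms(2), THEN monoid.one_closed]
    unfolding isometric_action_def faithful_on_def
    by (auto simp: one hom_mult[OF hom] hom_in_carrier[OF hom])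
       (metis hom hom_in_carrier inj_onD one)
  then show ?thesis by blast
qed

context bicharacter
begin

lemma heisenberg_group: "group (heisenberg V \<beta> \<psi>)"
proof (rule groupI)
  fix x assume "x \<in> carrier (heisenberg V \<beta> \<psi>)"
  then obtain v c where [simp]: "x = (v, \<psi> c)" and v: "v \<in> V" by auto
  show "\<exists>y\<in>carrier (heisenberg V \<beta> \<psi>). y \<otimes>\<^bsub>heisenberg V \<beta> \<psi>\<^esub> x = \<one>\<^bsub>heisenberg V \<beta> \<psi>\<^esub>"
    using v by (intro bexI[of _ "(- v, \<psi> (\<beta> v v - c))"])
      (auto simp: psi_add[symmetric] beta_simps V_minus)
qed (auto simp: V_add psi_add[symmetric] beta_simps beta_left.zero add_ac
       intro: range_eqI[of _ \<psi> 0])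

lemma heisenberg_finite: "finite (carrier (heisenberg V \<beta> \<psi>))"
  by simp

text \<open>Isometries preserve the cocycle itself and not merely the commutator, so acting on
  \<open>v\<close> and fixing the central component is multiplicative without correction.\<close>

lemma isometric_action_heisenberg:
  assumes act: "isometric_action G V \<beta> \<tau> a"
  shows "acts_by_automorphisms G (\<lambda>g (v, c). (a g v, c)) (heisenberg V \<beta> \<psi>)"
    and "faithful_on G (\<lambda>g (v, c). (a g v, c)) (carrier (heisenberg V \<beta> \<psi>))"
proof -
  show "acts_by_automorphisms G (\<lambda>g (v, c). (a g v, c)) (heisenberg V \<beta> \<psi>)"
    using act
    by (auto simp: acts_by_automorphisms_def isometric_action_def isometry_def hom_def)
  show "faithful_on G (\<lambda>g (v, c). (a g v, c)) (carrier (heisenberg V \<beta> \<psi>))"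
    using act by (auto simp: faithful_on_def isometric_action_def)
qed

end

section \<open>Action of the semidirect product on the module\<close>

context weil_module
begin

text \<open>If a multiple of \<open>\<rho> v\<close> is the identity, then \<open>\<rho> v\<close>
  commutes with every \<open>\<rho> w\<close>, so all commutators of \<open>v\<close> are 1 and
  nondegeneracy applies.\<close>

lemma scalar_rho_imp_zero:
  assumes v: "v \<in> V" and eq: "\<And>x. x \<in> M \<Longrightarrow> c *s \<rho> v x = x"
  shows "v = 0"
proof (rule nondegenerate[OF v])
  fix w assume w: "w \<in> V"
  show "\<psi> (\<beta> v w - \<beta> w v) = 1"
  proof (rule M_faithful)
    fix x assume x: "x \<in> M"
    let ?y = "\<rho> (- w) x"
    have 1: "c *s \<rho> (v + w) ?y = \<psi> (- \<beta> v w) *s \<rho> w ?y"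
      using eq[OF rho_M, of w ?y] by (metis rho_rho scale_left_commute scale_scale scale_one psi_minus_mult(1))
    have 2: "c *s \<rho> (v + w) ?y = \<psi> (- \<beta> w v) *s \<rho> w ?y"
    proof -
      have "\<rho> w ?y = c *s \<psi> (\<beta> w v) *s \<rho> (w + v) ?y"
        using arg_cong[OF eq[OF rho_M, of "- w" x], of "\<rho> w"] by (simp only: rho_scale rho_rho[of w v])
      then show ?thesis
        by (simp add: add.commute mult.left_commute mult.assoc[symmetric])
    qed
    have yx: "\<rho> w ?y = \<psi> (- \<beta> w w) *s x"
      by (simp add: rho_rho beta_simps rho_0 x)
    have "\<psi> (\<beta> w w + \<beta> v w) *s \<psi> (- \<beta> v w) *s \<rho> w ?y = \<psi> (\<beta> w w + \<beta> v w) *s \<psi> (- \<beta> w v) *s \<rho> w ?y"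
      using 1 2 by simp
    then show "\<psi> (\<beta> v w - \<beta> w v) *s x = 1 *s x"
      by (simp only: yx scale_scale psi_add[symmetric]) (simp add: algebra_simps)
  qed
qed

text \<open>A pair \<open>(g, n)\<close> stands for the product \<open>n g\<close>, so the isometry
  acts first and the Heisenberg element second.\<close>

definition semidirect_action :: "('g \<Rightarrow> 'v \<Rightarrow> 'v) \<Rightarrow> 'g \<times> 'v \<times> 'f \<Rightarrow> 'm \<Rightarrow> 'm" where
  "semidirect_action a = (\<lambda>(g, v, c) x. c *s \<rho> v (T (a g) x))"

text \<open>Multiplicativity is \<open>T_T\<close> together with \<open>T_rho\<close>; the form is
  preserved because the values of \<open>\<psi>\<close> have norm 1. All operators being linear,
  they commute with \<open>scale d\<close>, where \<open>d\<close> will be the scalar that serves as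
  the next \<open>\<tau>\<close>.\<close>

lemma isometric_action_semidirect:
  assumes "group G" and act: "isometric_action G V \<beta> \<tau> a"
  shows "isometric_action (semidirect_product G (\<lambda>g (v, c). (a g v, c)) (heisenberg V \<beta> \<psi>))
           M B (scale d) (semidirect_action a)"
proof -
  interpret G: group G by fact
  have isom: "isometry V \<beta> \<tau> (a g)" if "g \<in> carrier G" for g
    using act that by (simp add: isometric_action_def)
  have one: "a \<one>\<^bsub>G\<^esub> v = v" if "v \<in> V" for v
    using act that by (simp add: isometric_action_def)
  have comp: "a (g \<otimes>\<^bsub>G\<^esub> h) v = a g (a h v)" if "g \<in> carrier G" "h \<in> carrier G" "v \<in> V" for g h v
    using act that by (simp add: isometric_action_def)
  have inv: "a g (a (inv\<^bsub>G\<^esub> g) v) = v" "a (inv\<^bsub>G\<^esub> g) (a g v) = v"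
    if "g \<in> carrier G" "v \<in> V" for g v
    using that by (simp_all add: comp[symmetric] one G.r_inv G.l_inv)
  have TT: "T (a g) (T (a h) x) = T (a (g \<otimes>\<^bsub>G\<^esub> h)) x"
    if "g \<in> carrier G" "h \<in> carrier G" "x \<in> M" for g h x
    by (rule T_T[where k = "a (inv\<^bsub>G\<^esub> (g \<otimes>\<^bsub>G\<^esub> h))"]) (use that inv[of "g \<otimes>\<^bsub>G\<^esub> h"] in \<open>auto simp: isom comp\<close>)
  have TB: "B (T (a g) x) (T (a g) y) = B x y" if "g \<in> carrier G" "x \<in> M" "y \<in> M" for g x y
    by (rule B_T[where k = "a (inv\<^bsub>G\<^esub> g)"]) (use that in \<open>auto simp: isom inv\<close>)
  show ?thesis
    unfolding isometric_action_def
  proof (intro conjI ballI)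
    fix s assume "s \<in> carrier (semidirect_product G (\<lambda>g (v, c). (a g v, c)) (heisenberg V \<beta> \<psi>))"
    then obtain g v b where [simp]: "s = (g, v, \<psi> b)" and g: "g \<in> carrier G" and v: "v \<in> V"
      by auto
    show "isometry M B (scale d) (semidirect_action a s)"
      using g by (auto simp: isometry_def semidirect_action_def M_scale rho_M T_add T_scale
          rho_add rho_scale scale_right_distrib mult.commute B_scale_left B_scale_right bar_psi
          B_rho T_M TB mult.assoc[symmetric])
  next
    fix x assume "x \<in> M"
    then show "semidirect_action a
        \<one>\<^bsub>semidirect_product G (\<lambda>g (v, c). (a g v, c)) (heisenberg V \<beta> \<psi>)\<^esub> x = x"
      by (simp add: semidirect_action_def T_id one rho_0)
  next
    fix s t x
    assume "s \<in> carrier (semidirect_product G (\<lambda>g (v, c). (a g v, c)) (heisenberg V \<beta> \<psi>))"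
      "t \<in> carrier (semidirect_product G (\<lambda>g (v, c). (a g v, c)) (heisenberg V \<beta> \<psi>))" "x \<in> M"
    then show "semidirect_action a
        (s \<otimes>\<^bsub>semidirect_product G (\<lambda>g (v, c). (a g v, c)) (heisenberg V \<beta> \<psi>)\<^esub> t) x =
        semidirect_action a s (semidirect_action a t x)"
      by (auto simp: semidirect_action_def T_scale rho_scale T_rho[OF isom] rho_rho TT mult_ac)
  next
    show "faithful_on (semidirect_product G (\<lambda>g (v, c). (a g v, c)) (heisenberg V \<beta> \<psi>))
        (semidirect_action a) M"
      unfolding faithful_on_def
    proof (intro ballI impI)
      fix s assume "s \<in> carrier (semidirect_product G (\<lambda>g (v, c). (a g v, c)) (heisenberg V \<beta> \<psi>))"
        and triv: "\<forall>x\<in>M. semidirect_action a s x = x"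
      then obtain g v b where [simp]: "s = (g, v, \<psi> b)" and g: "g \<in> carrier G" and v: "v \<in> V"
        by auto
      have eq: "\<psi> b *s \<rho> v (T (a g) x) = x" if "x \<in> M" for x
        using triv that by (simp add: semidirect_action_def)
      have "a g w = w" if w: "w \<in> V" for w
      proof -
        have gw: "a g w \<in> V" using isometry_V[OF isom[OF g] w] .
        \<comment> \<open>Moving the operator that is assumed trivial past \<open>\<rho> w\<close>
          turns \<open>\<rho> w\<close> into a multiple of \<open>\<rho> (a g w)\<close>. So
          \<open>\<rho> (a g w - w)\<close> is a scalar, and \<open>g\<close> fixes
          \<open>w\<close>.\<close>
        have *: "\<rho> w x = \<psi> (\<beta> v (a g w) - \<beta> (a g w) v) *s \<rho> (a g w) x" if x: "x \<in> M" for x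
        proof -
          have "\<rho> w x = \<psi> b *s \<rho> v (T (a g) (\<rho> w x))"
            by (simp add: eq rho_M)
          also have "\<dots> = \<psi> (\<beta> v (a g w) - \<beta> (a g w) v) *s \<rho> (a g w) (\<psi> b *s \<rho> v (T (a g) x))"
            by (simp add: T_rho[OF isom[OF g] w] rho_rho rho_scale add.commute psi_add[symmetric]
                mult.left_commute)
          also have "\<dots> = \<psi> (\<beta> v (a g w) - \<beta> (a g w) v) *s \<rho> (a g w) x"
            by (simp add: eq x)
          finally show ?thesis .
        qed
        have "a g w - w = 0"
        proof (rule scalar_rho_imp_zero)
          show "a g w - w \<in> V" using gw w by (rule V_diff)
          let ?e = "\<beta> v (a g w) - \<beta> (a g w) v"
          show "\<psi> (?e + \<beta> w w - \<beta> (a g w) w) *s \<rho> (a g w - w) x = x" if x: "x \<in> M" for x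
          proof -
            have "x = \<psi> (\<beta> w w) *s \<rho> w (\<rho> (- w) x)"
              by (simp add: rho_rho beta_simps rho_0 x)
            also have "\<dots> = \<psi> (\<beta> w w) *s \<psi> ?e *s \<rho> (a g w) (\<rho> (- w) x)"
              by (subst *) (simp_all add: rho_M)
            also have "\<dots> = \<psi> (?e + \<beta> w w - \<beta> (a g w) w) *s \<rho> (a g w - w) x"
              by (simp add: rho_rho beta_simps psi_add[symmetric] algebra_simps)
            finally show ?thesis by simp
          qed
        qed
        then show ?thesis by simp
      qed
      then have [simp]: "g = \<one>\<^bsub>G\<^esub>"
        using act g by (auto simp: isometric_action_def faithful_on_def)
      have eq': "\<psi> b *s \<rho> v x = x" if "x \<in> M" for x
        using eq[OF that] by (simp add: T_id one that)
      then have [simp]: "v = 0"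
        using v by (blast intro: scalar_rho_imp_zero)
      have "\<psi> b = 1"
        by (rule M_faithful) (use eq' rho_0 in simp)
      then show "s = \<one>\<^bsub>semidirect_product G (\<lambda>g (v, c). (a g v, c)) (heisenberg V \<beta> \<psi>)\<^esub>"
        by simp
    qed
  qed
qed

end

section \<open>Tensor powers\<close>

text \<open>Vectors of length \<open>m\<close> are sequences vanishing from \<open>m\<close> on, so
  all dimensions share one type with pointwise addition.\<close>

definition funs_below :: "nat \<Rightarrow> (nat \<Rightarrow> 'k::zero) set" where
  "funs_below m = {v. \<forall>k\<ge>m. v k = 0}"

lemma funs_below_card:
  "card (funs_below m :: (nat \<Rightarrow> 'k::{zero, finite}) set) = CARD('k) ^ m"
  "finite (funs_below m :: (nat \<Rightarrow> 'k) set)"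
proof -
  have bij: "bij_betw (\<lambda>v. restrict v {..<m}) (funs_below m) (PiE {..<m} (\<lambda>_. UNIV :: 'k set))"
    by (rule bij_betwI[of _ _ _ "\<lambda>f k. if k < m then f k else 0"])
       (auto simp: funs_below_def fun_eq_iff PiE_def extensional_def)
  show "card (funs_below m :: (nat \<Rightarrow> 'k) set) = CARD('k) ^ m"
    using bij_betw_same_card[OF bij] by (simp add: card_PiE)
  show "finite (funs_below m :: (nat \<Rightarrow> 'k) set)"
    using bij_betw_finite[OF bij] by (simp add: finite_PiE)
qed

definition sum_form :: "('k \<Rightarrow> 'k \<Rightarrow> 'c::comm_monoid_add) \<Rightarrow> nat \<Rightarrow> (nat \<Rightarrow> 'k) \<Rightarrow> (nat \<Rightarrow> 'k) \<Rightarrow> 'c" where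
  "sum_form b m v w = (\<Sum>k<m. b (v k) (w k))"

abbreviation words :: "nat \<Rightarrow> (nat \<Rightarrow> 'x) set" where
  "words m \<equiv> PiE {..<m} (\<lambda>_. UNIV)"

lemma sum_words_prod:
  fixes F :: "nat \<Rightarrow> 'x::finite \<Rightarrow> 'f::comm_semiring_1"
  shows "(\<Sum>x\<in>words m. \<Prod>k<m. F k (x k)) = (\<Prod>k<m. \<Sum>y\<in>UNIV. F k y)"
  by (rule prod_sum_PiE[symmetric]) auto

lemma words_eq_iff:
  assumes "x \<in> words m" "y \<in> words m"
  shows "x = y \<longleftrightarrow> (\<forall>k<m. x k = y k)"
  using PiE_ext[OF assms] by auto

text \<open>Data for a single tensor factor: \<open>r\<close> holds the matrices of the
  representation, \<open>c\<close> the Gram matrix of the form they preserve. The conditions for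
  exponent \<open>m\<close> follow by products over the coordinates.\<close>

locale plane =
  fixes b :: "'k::{ab_group_add, finite} \<Rightarrow> 'k \<Rightarrow> 'c::{ab_group_add, finite}"
    and \<psi> :: "'c \<Rightarrow> 'f::comm_ring_1"
    and \<tau> :: "'k \<Rightarrow> 'k"
    and q :: nat
    and r :: "'k \<Rightarrow> 'x::finite \<Rightarrow> 'x \<Rightarrow> 'f"
    and c :: "'x \<Rightarrow> 'x \<Rightarrow> 'f"
    and bar :: "'f \<Rightarrow> 'f"
  assumes no_zero_divisors: "\<And>a b :: 'f. a * b = 0 \<Longrightarrow> a = 0 \<or> b = 0"
    and b_add_left: "b (u + v) w = b u w + b v w"
    and b_add_right: "b u (v + w) = b u v + b u w"
    and \<psi>_add: "\<psi> (s + t) = \<psi> s * \<psi> t"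
    and \<psi>_0: "\<psi> 0 = 1"
    and b_nondegenerate: "(\<And>w. \<psi> (b v w - b w v) = 1) \<Longrightarrow> v = 0"
    and \<tau>_add: "\<tau> (v + w) = \<tau> v + \<tau> w"
    and \<tau>_isometry: "b (\<tau> v) (\<tau> w) = b v w"
    and \<tau>_order: "(\<tau> ^^ q) v = v"
    and \<tau>_free: "0 < j \<Longrightarrow> j < q \<Longrightarrow> (\<tau> ^^ j) v = v \<Longrightarrow> v = 0"
    and q_positive: "0 < q"
    and q_zero: "of_nat q = (0::'f)"
    and card_plane: "of_nat CARD('k) = (1::'f)"
    and r_mult: "(\<Sum>y\<in>UNIV. r v x y * r w y z) = \<psi> (b v w) * r (v + w) x z"
    and r_0: "r 0 x y = (if x = y then 1 else 0)"
    and r_form: "(\<Sum>s\<in>UNIV. \<Sum>t\<in>UNIV. r v s x * c s t * bar (r v t y)) = c x y"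
    and bar_add: "bar (d + e) = bar d + bar e"
    and bar_mult: "bar (d * e) = bar d * bar e"
    and bar_1: "bar 1 = 1"
    and bar_\<psi>: "bar (\<psi> t) = \<psi> (- t)"
begin

definition R :: "nat \<Rightarrow> (nat \<Rightarrow> 'k) \<Rightarrow> (nat \<Rightarrow> 'x) \<Rightarrow> (nat \<Rightarrow> 'x) \<Rightarrow> 'f" where
  "R m v x y = (\<Prod>k<m. r (v k) (x k) (y k))"

definition op :: "nat \<Rightarrow> (nat \<Rightarrow> 'k) \<Rightarrow> ((nat \<Rightarrow> 'x) \<Rightarrow> 'f) \<Rightarrow> (nat \<Rightarrow> 'x) \<Rightarrow> 'f" where
  "op m v f = (\<lambda>x. if x \<in> words m then \<Sum>y\<in>words m. R m v x y * f y else 0)"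

definition tensors :: "nat \<Rightarrow> ((nat \<Rightarrow> 'x) \<Rightarrow> 'f) set" where
  "tensors m = {f. \<forall>x. x \<notin> words m \<longrightarrow> f x = 0}"

definition C :: "nat \<Rightarrow> (nat \<Rightarrow> 'x) \<Rightarrow> (nat \<Rightarrow> 'x) \<Rightarrow> 'f" where
  "C m x y = (\<Prod>k<m. c (x k) (y k))"

definition tensor_form :: "nat \<Rightarrow> ((nat \<Rightarrow> 'x) \<Rightarrow> 'f) \<Rightarrow> ((nat \<Rightarrow> 'x) \<Rightarrow> 'f) \<Rightarrow> 'f" where
  "tensor_form m f g = (\<Sum>x\<in>words m. \<Sum>y\<in>words m. f x * C m x y * bar (g y))"

lemma bar_0: "bar 0 = 0"
  using bar_add[of 0 0] by simp

lemma bar_sum: "bar (sum f A) = (\<Sum>i\<in>A. bar (f i))"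
  by (induction A rule: infinite_finite_induct) (simp_all add: bar_0 bar_add)

lemma bar_prod: "bar (prod f A) = (\<Prod>i\<in>A. bar (f i))"
  by (induction A rule: infinite_finite_induct) (simp_all add: bar_1 bar_mult)

lemma \<psi>_sum: "\<psi> (sum f A) = (\<Prod>i\<in>A. \<psi> (f i))"
  by (induction A rule: infinite_finite_induct) (simp_all add: \<psi>_0 \<psi>_add)

lemma finite_words: "finite (words m :: (nat \<Rightarrow> 'x) set)"
  by (rule finite_PiE) auto

text \<open>By distributivity a sum over words of a product over letters is a product of sums over
  single letters, which reduces the identity to \<open>r_mult\<close>.\<close>

lemma R_mult:
  "(\<Sum>y\<in>words m. R m v x y * R m w y z) = \<psi> (sum_form b m v w) * R m (v + w) x z"
proof -
  have "(\<Sum>y\<in>words m. R m v x y * R m w y z) =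
      (\<Sum>y\<in>words m. \<Prod>k<m. r (v k) (x k) (y k) * r (w k) (y k) (z k))"
    by (simp add: R_def prod.distrib)
  also have "\<dots> = (\<Prod>k<m. \<psi> (b (v k) (w k)) * r (v k + w k) (x k) (z k))"
    by (subst sum_words_prod[where F = "\<lambda>k u. r (v k) (x k) u * r (w k) u (z k)"]) (simp add: r_mult)
  finally show ?thesis
    by (simp add: R_def sum_form_def \<psi>_sum prod.distrib)
qed

lemma R_0:
  assumes "x \<in> words m" "y \<in> words m"
  shows "R m 0 x y = (if x = y then 1 else 0)"
proof (cases "x = y")
  case False
  then obtain k where "k < m" "x k \<noteq> y k"
    using words_eq_iff[OF assms] by blast
  then have "(\<Prod>k<m. r 0 (x k) (y k)) = 0"
    by (intro prod_zero) (auto simp: r_0)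
  with False show ?thesis by (simp add: R_def)
qed (simp add: R_def r_0)

lemma R_form:
  "(\<Sum>s\<in>words m. \<Sum>t\<in>words m. R m v s x * C m s t * bar (R m v t y)) = C m x y"
proof -
  have "(\<Sum>s\<in>words m. \<Sum>t\<in>words m. R m v s x * C m s t * bar (R m v t y)) =
      (\<Sum>s\<in>words m. \<Sum>t\<in>words m.
        \<Prod>k<m. r (v k) (s k) (x k) * c (s k) (t k) * bar (r (v k) (t k) (y k)))"
    by (simp add: R_def C_def bar_prod prod.distrib)
  also have "\<dots> = (\<Prod>k<m. \<Sum>s\<in>UNIV. \<Sum>t\<in>UNIV. r (v k) s (x k) * c s t * bar (r (v k) t (y k)))"
    by (subst sum_words_prod) (rule sum_words_prod)
  finally show ?thesis
    by (simp add: r_form C_def)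
qed

lemma op_op:
  "op m v (op m w f) = (\<lambda>x. \<psi> (sum_form b m v w) * op m (v + w) f x)"
proof
  fix x :: "nat \<Rightarrow> 'x"
  have "(\<Sum>y\<in>words m. R m v x y * (\<Sum>z\<in>words m. R m w y z * f z)) =
      (\<Sum>y\<in>words m. \<Sum>z\<in>words m. R m v x y * R m w y z * f z)"
    by (simp add: sum_distrib_left mult.assoc)
  also have "\<dots> = (\<Sum>z\<in>words m. (\<Sum>y\<in>words m. R m v x y * R m w y z) * f z)"
    by (subst sum.swap) (simp add: sum_distrib_right)
  also have "\<dots> = \<psi> (sum_form b m v w) * (\<Sum>z\<in>words m. R m (v + w) x z * f z)"
    by (simp add: R_mult sum_distrib_left mult.assoc)
  finally show "op m v (op m w f) x = \<psi> (sum_form b m v w) * op m (v + w) f x"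
    by (simp add: op_def)
qed

lemma op_0: "f \<in> tensors m \<Longrightarrow> op m 0 f = f"
proof
  fix x assume f: "f \<in> tensors m"
  show "op m 0 f x = f x"
  proof (cases "x \<in> words m")
    case True
    then have "(\<Sum>y\<in>words m. R m 0 x y * f y) = (\<Sum>y\<in>words m. if x = y then f y else 0)"
      by (intro sum.cong refl) (simp add: R_0)
    with True show ?thesis
      by (simp add: op_def finite_words)
  qed (use f in \<open>auto simp: op_def tensors_def\<close>)
qed

lemma tensor_form_op: "tensor_form m (op m v f) (op m v g) = tensor_form m f g"
proof -
  let ?W = "words m :: (nat \<Rightarrow> 'x) set"
  have "tensor_form m (op m v f) (op m v g) =
      (\<Sum>s\<in>?W. \<Sum>t\<in>?W. \<Sum>x\<in>?W. \<Sum>y\<in>?W.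
        f x * (R m v s x * C m s t * bar (R m v t y)) * bar (g y))"
    by (simp add: tensor_form_def op_def bar_sum bar_mult sum_distrib_left sum_distrib_right mult_ac)
  \<comment> \<open>The interchanges bring the sums over \<open>s\<close> and \<open>t\<close>
    innermost, where \<open>R_form\<close> evaluates them.\<close>
  also have "\<dots> = (\<Sum>s\<in>?W. \<Sum>x\<in>?W. \<Sum>t\<in>?W. \<Sum>y\<in>?W.
        f x * (R m v s x * C m s t * bar (R m v t y)) * bar (g y))"
    by (rule sum.cong[OF refl], rule sum.swap)
  also have "\<dots> = (\<Sum>x\<in>?W. \<Sum>s\<in>?W. \<Sum>t\<in>?W. \<Sum>y\<in>?W.
        f x * (R m v s x * C m s t * bar (R m v t y)) * bar (g y))"
    by (rule sum.swap)
  also have "\<dots> = (\<Sum>x\<in>?W. \<Sum>s\<in>?W. \<Sum>y\<in>?W. \<Sum>t\<in>?W.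
        f x * (R m v s x * C m s t * bar (R m v t y)) * bar (g y))"
    by (rule sum.cong[OF refl], rule sum.cong[OF refl], rule sum.swap)
  also have "\<dots> = (\<Sum>x\<in>?W. \<Sum>y\<in>?W. \<Sum>s\<in>?W. \<Sum>t\<in>?W.
        f x * (R m v s x * C m s t * bar (R m v t y)) * bar (g y))"
    by (rule sum.cong[OF refl], rule sum.swap)
  also have "\<dots> = tensor_form m f g"
    by (simp add: tensor_form_def R_form sum_distrib_left[symmetric] sum_distrib_right[symmetric])
  finally show ?thesis .
qed

lemma sum_form_add:
  "sum_form b m (u + v) w = sum_form b m u w + sum_form b m v w"
  "sum_form b m u (v + w) = sum_form b m u v + sum_form b m u w"
  by (simp_all add: sum_form_def b_add_left b_add_right sum.distrib)

lemma \<tau>_pow: "((\<lambda>v k. \<tau> (v k)) ^^ j) v = (\<lambda>k. (\<tau> ^^ j) (v k))"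
  by (induction j) simp_all

lemma \<tau>_0: "\<tau> 0 = 0"
  using \<tau>_add[of 0 0] by simp

sublocale bicharacter "funs_below m" "sum_form b m" \<psi> for m
proof
  fix v :: "nat \<Rightarrow> 'k"
  assume v: "v \<in> funs_below m"
    and 1: "\<And>w. w \<in> funs_below m \<Longrightarrow> \<psi> (sum_form b m v w - sum_form b m w v) = 1"
  have b0: "b 0 u = 0" "b u 0 = 0" for u
    using b_add_left[of 0 0 u] b_add_right[of u 0 0] by simp_all
  show "v = 0"
  proof
    fix k
    show "v k = 0 k"
    proof (cases "k < m")
      case True
      have "v k = 0"
      proof (rule b_nondegenerate)
        fix u :: 'k
        let ?w = "\<lambda>i. if i = k then u else 0"
        have delta: "b (v i) (?w i) = (if i = k then b (v k) u else 0)"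
          "b (?w i) (v i) = (if i = k then b u (v k) else 0)" for i
          by (simp_all add: b0)
        have "sum_form b m v ?w = b (v k) u" "sum_form b m ?w v = b u (v k)"
          using True by (simp_all add: sum_form_def delta)
        then show "\<psi> (b (v k) u - b u (v k)) = 1"
          using 1[of ?w] True by (simp add: funs_below_def)
      qed
      then show ?thesis by simp
    qed (use v in \<open>simp add: funs_below_def\<close>)
  qed
qed (simp_all add: sum_form_add \<psi>_add \<psi>_0 funs_below_card, simp_all add: funs_below_def)

sublocale weil_module "funs_below m" "sum_form b m" \<psi> "\<lambda>a f x. a * f x" "\<lambda>v k. \<tau> (v k)" q
  "tensors m" "op m" "tensor_form m" bar for m
proof
  show "\<And>v. v \<in> funs_below m \<Longrightarrow> ((\<lambda>v k. \<tau> (v k)) ^^ q) v = v"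
    by (simp add: \<tau>_pow \<tau>_order)
  show "\<And>v j. v \<in> funs_below m \<Longrightarrow> 0 < j \<Longrightarrow> j < q \<Longrightarrow> ((\<lambda>v k. \<tau> (v k)) ^^ j) v = v \<Longrightarrow> v = 0"
    by (auto simp: \<tau>_pow fun_eq_iff intro: \<tau>_free)
  fix a d :: 'f
  assume eq: "\<And>f. f \<in> tensors m \<Longrightarrow> (\<lambda>x. a * f x) = (\<lambda>x. d * f x)"
  \<comment> \<open>The indicator function of any single word separates scalars; the word with
    \<open>undefined\<close> entries exists for every \<open>m\<close>.\<close>
  let ?x = "\<lambda>k\<in>{..<m}. undefined :: 'x"
  have "(\<lambda>x. if x = ?x then 1 else 0) \<in> tensors m"
    by (auto simp: tensors_def)
  from fun_cong[OF eq[OF this], of ?x] show "a = d" by simp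
next
  show "\<And>v x y. op m v (x + y) = op m v x + op m v y"
    by (simp add: fun_eq_iff op_def ring_distribs sum.distrib)
  show "\<And>v a x. op m v (\<lambda>i. a * x i) = (\<lambda>i. a * op m v x i)"
    by (simp add: fun_eq_iff op_def sum_distrib_left mult.left_commute)
  show "\<And>x y z. tensor_form m (x + y) z = tensor_form m x z + tensor_form m y z"
    "\<And>x y z. tensor_form m x (y + z) = tensor_form m x y + tensor_form m x z"
    by (simp_all add: tensor_form_def bar_add ring_distribs sum.distrib)
  show "\<And>a x y. tensor_form m (\<lambda>i. a * x i) y = a * tensor_form m x y"
    "\<And>a x y. tensor_form m x (\<lambda>i. a * y i) = bar a * tensor_form m x y"
    by (simp_all add: tensor_form_def bar_mult sum_distrib_left mult_ac)
  show "\<And>v w x. op m v (op m w x) = (\<lambda>i. \<psi> (sum_form b m v w) * op m (v + w) x i)"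
    by (rule op_op)
qed (simp_all add: fun_eq_iff ring_distribs no_zero_divisors funs_below_card card_plane \<tau>_add
    sum_form_def \<tau>_isometry q_positive q_zero op_0 tensor_form_op bar_\<psi>,
    simp_all add: op_def tensors_def funs_below_def \<tau>_0)

end

section \<open>The two planes\<close>

lemma F3_cases:
  fixes x :: 3
  obtains "x = 0" | "x = 1" | "x = - 1"
proof -
  have "(3::3) = 0" "(2::3) = - 1" by auto
  then show ?thesis
    using exhaust_3[of x] that by metis
qed

lemma F3_3: "(3::3) = 0"
  by auto

lemma F3_simps:
  "(1::3) + 1 = - 1" "(2::3) = - 1" "(- 1::3) - 1 = 1" "(1::3) \<noteq> - 1" "(- 1::3) \<noteq> 1"
  by auto

lemma F3_no_zero_divisors:
  fixes x y :: 3
  assumes "x * y = 0"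
  shows "x = 0 \<or> y = 0"
  using assms by (cases x rule: F3_cases; cases y rule: F3_cases) auto

text \<open>\<^term>\<open>GF4 a b\<close> stands for \<open>a + b \<omega>\<close> with \<open>\<omega>\<^sup>2 = \<omega> + 1\<close>.\<close>
datatype gf4 = GF4 bool bool

instantiation gf4 :: comm_ring_1
begin

definition "0 = GF4 False False"
definition "1 = GF4 True False"
fun plus_gf4 where "GF4 a b + GF4 c d = GF4 (a \<noteq> c) (b \<noteq> d)"
definition "- x = (x :: gf4)"
definition "x - y = (x + y :: gf4)"
fun times_gf4 where
  "GF4 a b * GF4 c d = GF4 ((a \<and> c) \<noteq> (b \<and> d)) ((a \<and> d) \<noteq> ((b \<and> c) \<noteq> (b \<and> d)))"

instance
proof
  fix x y z :: gf4
  show "x + y + z = x + (y + z)" "x * y * z = x * (y * z)" "(x + y) * z = x * z + y * z"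
    by (cases x; cases y; cases z; auto)+
  show "x + y = y + x" "x * y = y * x" "x - y = x + - y"
    by (cases x; cases y; auto simp: uminus_gf4_def minus_gf4_def)+
  show "0 + x = x" "1 * x = x" "- x + x = 0" "(0::gf4) \<noteq> 1"
    by (cases x; auto simp: zero_gf4_def one_gf4_def uminus_gf4_def)+
qed

end

lemma gf4_cases:
  obtains "x = GF4 False False" | "x = GF4 False True" | "x = GF4 True False" | "x = GF4 True True"
  by (cases x) metis

lemma gf4_UNIV:
  "(UNIV :: gf4 set) = {GF4 False False, GF4 False True, GF4 True False, GF4 True True}"
  using gf4_cases by blast

instance gf4 :: finite
  by standard (simp add: gf4_UNIV)

lemmas gf4_simps = zero_gf4_def one_gf4_def uminus_gf4_def minus_gf4_def

text \<open>The Frobenius map, which exchanges \<open>\<omega>\<close> and its square.\<close>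

fun gf4_conj :: "gf4 \<Rightarrow> gf4" where
  "gf4_conj (GF4 a b) = GF4 (a \<noteq> b) b"

definition \<omega> :: gf4 where
  "\<omega> = GF4 False True"

definition psi3 :: "3 \<Rightarrow> gf4" where
  "psi3 a = (if a = 0 then 1 else if a = 1 then \<omega> else \<omega> * \<omega>)"

text \<open>Not the trace character, which is invariant under conjugation and would make the
  Heisenberg group commutative. Its value -1 at 1, the norm of every nonzero element, makes
  noncentral elements over F_4 square to the central involution, as in the quaternion group.\<close>

fun psi4 :: "gf4 \<Rightarrow> 3" where
  "psi4 (GF4 a b) = (if a then - 1 else 1)"

text \<open>The negative of the determinant form. Being alternating, it gives all elements of the
  Heisenberg group order dividing 3.\<close>

fun form3 :: "3 \<times> 3 \<Rightarrow> 3 \<times> 3 \<Rightarrow> 3" where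
  "form3 (a, b) (a', b') = a' * b - a * b'"

definition form4 :: "gf4 \<Rightarrow> gf4 \<Rightarrow> gf4" where
  "form4 v w = v * gf4_conj w"

text \<open>The Schroedinger representation on functions on F_3: translation by \<open>a\<close>,
  then modulation by \<open>b\<close>. The phase \<open>- a * b\<close> is \<open>a * b / 2\<close>,
  since 1/2 is -1 in F_3; this symmetric normalisation makes the cocycle alternating.\<close>

fun rep3 :: "3 \<times> 3 \<Rightarrow> 3 \<Rightarrow> 3 \<Rightarrow> gf4" where
  "rep3 (a, b) x y = (if y = x + a then psi3 (b * x - a * b) else 0)"

text \<open>The matrices of \<open>1\<close>, \<open>- i\<close>, \<open>- j\<close>, \<open>- k\<close> in \<open>SL\<^sub>2(3)\<close>, at \<open>0\<close>, \<open>1\<close>, \<open>\<omega>\<close>, \<open>\<omega>\<^sup>2\<close>.\<close>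
fun rep4 :: "gf4 \<Rightarrow> bool \<Rightarrow> bool \<Rightarrow> 3" where
  "rep4 (GF4 False False) x y = (if x = y then 1 else 0)"
| "rep4 (GF4 True False) x y = (if x = y then 0 else if x then - 1 else 1)"
| "rep4 (GF4 False True) x y = (if x \<and> y then 1 else - 1)"
| "rep4 (GF4 True True) x y = (if x \<or> y then - 1 else 1)"

text \<open>The determinant form on F_3^2, invariant under the matrices of \<open>rep4\<close>
  because they have determinant 1.\<close>

definition alt2 :: "bool \<Rightarrow> bool \<Rightarrow> 3" where
  "alt2 x y = (if x = y then 0 else if x then - 1 else 1)"

lemma psi3_add: "psi3 (a + b) = psi3 a * psi3 b"
  by (cases a rule: F3_cases; cases b rule: F3_cases)
     (auto simp: psi3_def \<omega>_def gf4_simps F3_simps)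

lemma psi3_eq_1_iff: "psi3 a = 1 \<longleftrightarrow> a = 0"
  by (auto simp: psi3_def \<omega>_def gf4_simps)

interpretation plane4: plane form4 psi4 "\<lambda>v. \<omega> * v" 3 rep4 alt2 "\<lambda>x. x"
proof
  fix v w u :: gf4
  show "form4 (u + v) w = form4 u w + form4 v w" "form4 u (v + w) = form4 u v + form4 u w"
    "form4 (\<omega> * v) (\<omega> * w) = form4 v w"
    by (cases u; cases v; cases w; auto simp: form4_def \<omega>_def)+
  show "psi4 (u + v) = psi4 u * psi4 v"
    by (cases u; cases v; auto)
  show "psi4 v = psi4 (- v)"
    by (simp add: gf4_simps)
  show "\<omega> * (v + w) = \<omega> * v + \<omega> * w"
    by (simp add: distrib_left)
  show "((*) \<omega> ^^ 3) v = v"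
    by (cases v) (auto simp: numeral_3_eq_3 \<omega>_def)
  show "v = 0" if "0 < j" "j < 3" "((*) \<omega> ^^ j) v = v" for j
  proof -
    have "j = 1 \<or> j = 2" using that by auto
    then show ?thesis
      using that(3) by (cases v) (auto simp: numeral_2_eq_2 \<omega>_def gf4_simps)
  qed
  show "v = 0" if "\<And>w. psi4 (form4 v w - form4 w v) = 1"
    using that[of 1] that[of \<omega>] 
    by (cases v) (auto simp: form4_def \<omega>_def gf4_simps F3_simps split: if_splits)
  fix x y z :: bool
  show "(\<Sum>y\<in>UNIV. rep4 v x y * rep4 w y z) = psi4 (form4 v w) * rep4 (v + w) x z"
    by (cases v rule: gf4_cases; cases w rule: gf4_cases; cases x; cases z)
       (auto simp: UNIV_bool form4_def F3_simps)
  show "(\<Sum>s\<in>UNIV. \<Sum>t\<in>UNIV. rep4 v s x * alt2 s t * rep4 v t y) = alt2 x y"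
    by (cases v rule: gf4_cases; cases x; cases y)
       (auto simp: UNIV_bool alt2_def F3_simps)
  show "rep4 0 x y = (if x = y then 1 else 0)"
    by (simp add: gf4_simps)
qed (auto simp: gf4_simps F3_no_zero_divisors card_UNIV_bool gf4_UNIV)

interpretation plane3: plane form3 psi3 uminus 2 rep3 "\<lambda>x y. if x = y then 1 else 0" gf4_conj
proof
  show "s = 0 \<or> t = 0" if "s * t = 0" for s t :: gf4
    using that by (cases s; cases t) (auto simp: gf4_simps)
  fix v w u :: "3 \<times> 3"
  obtain a b where v: "v = (a, b)" by (cases v)
  obtain a' b' where w: "w = (a', b')" by (cases w)
  obtain a'' b'' where u: "u = (a'', b'')" by (cases u)
  show "form3 (u + v) w = form3 u w + form3 v w" "form3 u (v + w) = form3 u v + form3 u w"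
    "form3 (- v) (- w) = form3 v w"
    by (simp_all add: u v w algebra_simps)
  show "v = 0" if "\<And>w. psi3 (form3 v w - form3 w v) = 1"
  proof -
    have "b + b = 0" "- a - a = 0"
      using that[of "(1, 0)"] that[of "(0, 1)"] by (simp_all add: v psi3_eq_1_iff)
    then show ?thesis
      by (cases a rule: F3_cases; cases b rule: F3_cases) (auto simp: v F3_simps zero_prod_def)
  qed
  show "v = 0" if "0 < j" "j < 2" "(uminus ^^ j) v = v" for j
  proof -
    have "j = 1" using that by auto
    then show ?thesis
      using that(3)
      by (cases a rule: F3_cases; cases b rule: F3_cases) (auto simp: v F3_simps zero_prod_def)
  qed
  fix x y z :: 3
  \<comment> \<open>The phases agree only modulo 3, because -1 stands for 1/2.\<close>
  have e: "(b * x - a * b) + (b' * (x + a) - a' * b') =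
      (a' * b - a * b') + ((b + b') * x - (a + a') * (b + b'))"
  proof -
    have "((b * x - a * b) + (b' * (x + a) - a' * b')) -
        ((a' * b - a * b') + ((b + b') * x - (a + a') * (b + b'))) = 3 * (a * b')"
      by (simp add: algebra_simps)
    also have "\<dots> = 0"
      using F3_3 by (simp only: mult_zero_left)
    finally show ?thesis by simp
  qed
  have "(\<Sum>y\<in>UNIV. rep3 v x y * rep3 w y z) =
      (\<Sum>y\<in>UNIV. if y = x + a then psi3 (b * x - a * b) * rep3 w y z else 0)"
    by (intro sum.cong refl) (simp add: v)
  also have "\<dots> = (if z = x + a + a' then
      psi3 (b * x - a * b) * psi3 (b' * (x + a) - a' * b') else 0)"
    by (simp add: w)
  also have "\<dots> = psi3 (form3 v w) * rep3 (v + w) x z"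
    by (simp add: psi3_add[symmetric] e v w add.assoc)
  finally show "(\<Sum>y\<in>UNIV. rep3 v x y * rep3 w y z) = psi3 (form3 v w) * rep3 (v + w) x z" .
  show "rep3 0 x y = (if x = y then 1 else 0)"
    by (auto simp: zero_prod_def psi3_def)
  have c0: "gf4_conj 0 = 0"
    by (simp add: gf4_simps)
  \<comment> \<open>Values of \<open>psi3\<close> have norm 1, so the monomial matrices of
    \<open>rep3\<close> are unitary.\<close>
  have n: "psi3 d * gf4_conj (psi3 d) = 1" for d
    by (auto simp: psi3_def \<omega>_def gf4_simps)
  have "(\<Sum>s\<in>UNIV. \<Sum>t\<in>UNIV. rep3 v s x * (if s = t then 1 else 0) * gf4_conj (rep3 v t y)) =
      (\<Sum>s\<in>UNIV. rep3 v s x * gf4_conj (rep3 v s y))"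
    by (intro sum.cong refl) (simp add: if_distrib[of "\<lambda>u. u * _"] if_distrib[of "(*) _"] cong: if_cong)
  also have "\<dots> = (\<Sum>s\<in>UNIV. if s = x - a then (if x = y then 1 else 0) else 0)"
    by (intro sum.cong refl) (auto simp: v n c0)
  finally show "(\<Sum>s\<in>UNIV. \<Sum>t\<in>UNIV. rep3 v s x * (if s = t then 1 else 0) * gf4_conj (rep3 v t y)) =
      (if x = y then 1 else 0)" by simp
next
  fix d e :: gf4
  show "gf4_conj (d + e) = gf4_conj d + gf4_conj e" "gf4_conj (d * e) = gf4_conj d * gf4_conj e"
    by (cases d; cases e; auto)+
  fix t :: 3
  show "gf4_conj (psi3 t) = psi3 (- t)"
    by (cases t rule: F3_cases) (auto simp: psi3_def \<omega>_def gf4_simps F3_simps)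
  have two: "(2::gf4) = 0"
    by (simp only: one_add_one[symmetric]) (simp add: gf4_simps)
  show "of_nat 2 = (0::gf4)"
    by (simp add: two)
  have "(9::gf4) = 2 * 4 + 1"
    by simp
  then show "of_nat CARD(3 \<times> 3) = (1::gf4)"
    by (simp add: two)
  show "psi3 0 = 1"
    by (simp add: psi3_def)
  show "gf4_conj 1 = 1"
    by (simp add: gf4_simps)
  show "(uminus ^^ 2) v = v" for v :: "3 \<times> 3"
    by (simp add: numeral_2_eq_2)
qed (simp_all add: psi3_add)

section \<open>Central powers\<close>

context bicharacter
begin

text \<open>Commuting with all \<open>(w, 1)\<close> forces the commutator character of
  \<open>v\<close> to be trivial, hence \<open>v = 0\<close>. This makes the relations of a central
  power explicit.\<close>

lemma heisenberg_center:
  "group_center (heisenberg V \<beta> \<psi>) = {0 :: 'v} \<times> range \<psi>"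
proof (rule equalityI; rule subsetI)
  fix z assume z: "z \<in> group_center (heisenberg V \<beta> \<psi>)"
  then obtain v s where [simp]: "z = (v, \<psi> s)" and v: "v \<in> V"
    by (auto simp: group_center_def)
  have "v = 0"
  proof (rule nondegenerate[OF v])
    fix w assume w: "w \<in> V"
    have "(v, \<psi> s) \<otimes>\<^bsub>heisenberg V \<beta> \<psi>\<^esub> (w, \<psi> 0) = (w, \<psi> 0) \<otimes>\<^bsub>heisenberg V \<beta> \<psi>\<^esub> (v, \<psi> s)"
      using z w by (auto simp: group_center_def simp del: psi_0)
    then have "\<psi> s * \<psi> (\<beta> v w) = \<psi> s * \<psi> (\<beta> w v)"
      by simp
    then have "\<psi> (- s) * \<psi> s * (\<psi> (\<beta> v w) * \<psi> (- \<beta> w v)) =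
        \<psi> (- s) * \<psi> s * (\<psi> (\<beta> w v) * \<psi> (- \<beta> w v))"
      by (simp only: mult.assoc mult.left_commute[of "\<psi> s"])
         (metis mult.assoc mult.left_commute)
    then show "\<psi> (\<beta> v w - \<beta> w v) = 1"
      by (simp add: psi_diff)
  qed
  then show "z \<in> {0 :: 'v} \<times> range \<psi>" by simp
next
  fix z assume "z \<in> {0 :: 'v} \<times> range \<psi>"
  then show "z \<in> group_center (heisenberg V \<beta> \<psi>)"
    by (auto simp: group_center_def beta_left.zero beta_right.zero mult.commute)
qed

end

lemma iso_group_center:
  assumes "group G" and "\<theta> \<in> iso G H"
  shows "x \<in> group_center G \<longleftrightarrow> x \<in> carrier G \<and> \<theta> x \<in> group_center H"
proof -
  have hom: "\<theta> \<in> hom G H" and inj: "inj_on \<theta> (carrier G)" and surj: "\<theta> ` carrier G = carrier H"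
    using assms(2) by (auto simp: iso_def bij_betw_def)
  interpret G: group G by fact
  show ?thesis
  proof (intro iffI conjI)
    assume x: "x \<in> group_center G"
    then show "x \<in> carrier G" by (simp add: group_center_def)
    with x show "\<theta> x \<in> group_center H"
      unfolding group_center_def surj[symmetric]
      by (auto simp: hom_mult[OF hom, symmetric])
  next
    assume x: "x \<in> carrier G \<and> \<theta> x \<in> group_center H"
    have "x \<otimes>\<^bsub>G\<^esub> y = y \<otimes>\<^bsub>G\<^esub> x" if y: "y \<in> carrier G" for y
    proof -
      have "\<theta> (x \<otimes>\<^bsub>G\<^esub> y) = \<theta> (y \<otimes>\<^bsub>G\<^esub> x)"
        using x y hom_in_carrier[OF hom y] by (simp add: hom_mult[OF hom] group_center_def)
      moreover have "x \<otimes>\<^bsub>G\<^esub> y \<in> carrier G \<and> y \<otimes>\<^bsub>G\<^esub> x \<in> carrier G"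
        using x y by simp
      ultimately show ?thesis
        using inj by (auto dest: inj_onD)
    qed
    with x show "x \<in> group_center G"
      by (simp add: group_center_def)
  qed
qed

context plane
begin

lemma bicharacter_plane: "bicharacter UNIV b \<psi>"
  by standard (auto simp: b_add_left b_add_right \<psi>_add \<psi>_0 intro: b_nondegenerate)

text \<open>The map multiplies the central components of the factors; its kernel is generated by the
  identifications of the centres.\<close>
lemma central_power_iso:
  assumes H: "group H" and \<theta>: "\<theta> \<in> iso H (heisenberg UNIV b \<psi>)" and m: "0 < m"
  shows "group (central_power H m)"
    and "central_power H m \<cong> heisenberg (funs_below m) (sum_form b m) \<psi>"
proof -
  let ?K = "heisenberg UNIV b \<psi>" and ?L = "heisenberg (funs_below m) (sum_form b m) \<psi>"
  interpret H: group H by fact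
  interpret K: group ?K by (rule bicharacter.heisenberg_group[OF bicharacter_plane])
  interpret L: group ?L by (rule heisenberg_group)
  define P where "P = product_group {..<m} (\<lambda>_. H)"
  interpret P: group P
    unfolding P_def by (rule product_group) (rule H)
  define S where "S = {coord_embedding H m i z \<otimes>\<^bsub>P\<^esub> inv\<^bsub>P\<^esub> coord_embedding H m j z | i j z.
      i < m \<and> j < m \<and> z \<in> group_center H}"
  have cp: "central_power H m = P Mod generate P S"
    by (simp add: central_power_def P_def S_def Let_def)
  have hom: "\<theta> \<in> hom H ?K" and inj: "inj_on \<theta> (carrier H)" and surj: "\<theta> ` carrier H = carrier ?K"
    using \<theta> by (auto simp: iso_def bij_betw_def)
  have one: "\<theta> \<one>\<^bsub>H\<^esub> = (0, 1)"
    using hom_one[OF hom H K.is_group] by simp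
  have center: "z \<in> group_center H \<longleftrightarrow> z \<in> carrier H \<and> fst (\<theta> z) = 0" for z
    using iso_group_center[OF H \<theta>, of z] bicharacter.heisenberg_center[OF bicharacter_plane]
      hom_in_carrier[OF hom, of z] by (auto simp: mem_Times_iff)
  have carrier_P: "f \<in> carrier P \<Longrightarrow> k < m \<Longrightarrow> f k \<in> carrier H" for f k
    by (auto simp: P_def)
  have snd_range: "snd (\<theta> x) \<in> range \<psi>" if "x \<in> carrier H" for x
    using hom_in_carrier[OF hom that] by (auto simp: mem_Times_iff)
  have mult_P: "(f \<otimes>\<^bsub>P\<^esub> g) k = f k \<otimes>\<^bsub>H\<^esub> g k" if "k < m" for f g k
    using that by (simp add: P_def)
  have inv_P: "(inv\<^bsub>P\<^esub> f) k = inv\<^bsub>H\<^esub> (f k)" if "f \<in> carrier P" "k < m" for f k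
    using that H by (simp add: P_def)
  have ext_P: "f = g" if "f \<in> carrier P" "g \<in> carrier P" "\<And>k. k < m \<Longrightarrow> f k = g k" for f g
    using that unfolding P_def by (auto intro: PiE_ext)
  define \<pi> where "\<pi> f = (\<lambda>k. if k < m then fst (\<theta> (f k)) else 0, \<Prod>k<m. snd (\<theta> (f k)))" for f
  have prod_range: "(\<Prod>k<n. g k) \<in> range \<psi>" if "\<And>k. k < n \<Longrightarrow> g k \<in> range \<psi>" for g and n :: nat
    using that
  proof (induction n)
    case 0
    then show ?case by (auto intro: range_eqI[of _ \<psi> 0])
  next
    case (Suc n)
    from Suc.prems[of n] obtain s where "g n = \<psi> s" by auto
    moreover from Suc obtain t where "(\<Prod>k<n. g k) = \<psi> t" by auto
    ultimately show ?case by (auto simp: \<psi>_add[symmetric])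
  qed
  have "\<pi> \<in> hom P ?L"
  proof (rule homI)
    fix f assume "f \<in> carrier P"
    then show "\<pi> f \<in> carrier ?L"
      using prod_range[of m "\<lambda>k. snd (\<theta> (f k))"]
      by (auto simp: \<pi>_def funs_below_def carrier_P snd_range)
  next
    fix f g assume fg: "f \<in> carrier P" "g \<in> carrier P"
    have \<theta>fg: "\<theta> (f k \<otimes>\<^bsub>H\<^esub> g k) = (fst (\<theta> (f k)) + fst (\<theta> (g k)),
        snd (\<theta> (f k)) * snd (\<theta> (g k)) * \<psi> (b (fst (\<theta> (f k))) (fst (\<theta> (g k)))))"
      if "k < m" for k
      using fg that
      by (cases "\<theta> (f k)"; cases "\<theta> (g k)") (simp add: hom_mult[OF hom] carrier_P)
    show "\<pi> (f \<otimes>\<^bsub>P\<^esub> g) = \<pi> f \<otimes>\<^bsub>?L\<^esub> \<pi> g"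
      by (auto simp: \<pi>_def mult_P \<theta>fg fun_eq_iff prod.distrib sum_form_def \<psi>_sum)
  qed
  then interpret \<pi>: group_hom P ?L \<pi>
    by (simp add: group_hom_def group_hom_axioms_def P.is_group L.is_group)
  have "\<pi> ` carrier P = carrier ?L"
  proof (intro subset_antisym subsetI)
    fix y assume "y \<in> carrier ?L"
    then obtain v s where y: "y = (v, \<psi> s)" and v: "v \<in> funs_below m" by auto
    have "(v k, if k = 0 then \<psi> s else 1) \<in> \<theta> ` carrier H" for k
      unfolding surj using range_eqI[of 1 \<psi> 0] by (auto simp: \<psi>_0)
    then have "\<forall>k. \<exists>x. x \<in> carrier H \<and> \<theta> x = (v k, if k = 0 then \<psi> s else 1)"
      by (metis imageE)
    then obtain f where f: "\<And>k. f k \<in> carrier H" "\<And>k. \<theta> (f k) = (v k, if k = 0 then \<psi> s else 1)"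
      by metis
    \<comment> \<open>The preimage carries the whole central component at coordinate 0, which exists
      as \<open>0 < m\<close>.\<close>
    have "(\<Prod>k<m. if k = 0 then \<psi> s else 1) = \<psi> s"
      using m by simp
    then have "\<pi> (restrict f {..<m}) = y"
      using v by (auto simp: \<pi>_def y f(2) fun_eq_iff funs_below_def)
    moreover have "restrict f {..<m} \<in> carrier P"
      using f(1) by (auto simp: P_def)
    ultimately show "y \<in> \<pi> ` carrier P" by blast
  next
    fix y assume "y \<in> \<pi> ` carrier P"
    then show "y \<in> carrier ?L"
      using \<pi>.hom_closed by blast
  qed
  note iso = \<pi>.FactGroup_iso_set[OF this]
  have coord_P: "coord_embedding H m i z \<in> carrier P" if "z \<in> carrier H" for i z
    using that by (auto simp: coord_embedding_def P_def)
  have coord: "coord_embedding H m i z k = (if k = i then z else \<one>\<^bsub>H\<^esub>)" if "k < m" for i z k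
    using that by (simp add: coord_embedding_def)
  have \<pi>_coord: "\<pi> (coord_embedding H m i z) = (0, snd (\<theta> z))"
    if "i < m" "z \<in> group_center H" for i z
  proof -
    have "(\<Prod>k<m. if k = i then snd (\<theta> z) else 1) = snd (\<theta> z)"
      using that(1) by simp
    moreover have "(\<Prod>k<m. snd (\<theta> (coord_embedding H m i z k))) =
        (\<Prod>k<m. if k = i then snd (\<theta> z) else 1)"
      by (intro prod.cong refl) (simp add: coord one)
    ultimately show ?thesis
      using that by (auto simp: \<pi>_def fun_eq_iff coord one center)
  qed
  have S_kernel: "S \<subseteq> kernel P ?L \<pi>"
  proof
    fix s assume "s \<in> S"
    then obtain i j z where s: "s = coord_embedding H m i z \<otimes>\<^bsub>P\<^esub> inv\<^bsub>P\<^esub> coord_embedding H m j z"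
      and ij: "i < m" "j < m" and z: "z \<in> group_center H" by (auto simp: S_def)
    then have "z \<in> carrier H" by (simp add: center)
    note c = coord_P[OF this]
    have "\<pi> s = \<pi> (coord_embedding H m i z) \<otimes>\<^bsub>?L\<^esub> inv\<^bsub>?L\<^esub> \<pi> (coord_embedding H m j z)"
      unfolding s by (simp only: \<pi>.hom_mult \<pi>.hom_inv c P.inv_closed)
    also have "\<pi> (coord_embedding H m j z) = \<pi> (coord_embedding H m i z)"
      by (simp add: \<pi>_coord ij z)
    finally have "\<pi> s = \<one>\<^bsub>?L\<^esub>"
      using \<pi>.hom_closed[OF c, of i] by (simp only: L.r_inv)
    moreover have "s \<in> carrier P"
      unfolding s by (intro P.m_closed P.inv_closed c)
    ultimately show "s \<in> kernel P ?L \<pi>"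
      by (simp add: kernel_def)
  qed
  interpret ker: subgroup "kernel P ?L \<pi>" P
    by (rule \<pi>.subgroup_kernel)
  have S_P: "S \<subseteq> carrier P"
    using S_kernel ker.subset by blast
  \<comment> \<open>Induction on a bound \<open>n\<close> for the support. Entries of a kernel
    element are central, so multiplying by the inverse of a relation moves the entry at
    \<open>n - 1\<close> to coordinate 0. Once only coordinate 0 is left, its central component
    equals the total product 1, so the element is trivial.\<close>
  have gen: "f \<in> generate P S"
    if "f \<in> kernel P ?L \<pi>" "\<And>k. n \<le> k \<Longrightarrow> k < m \<Longrightarrow> f k = \<one>\<^bsub>H\<^esub>" "n \<le> m" for f n
    using that
  proof (induction n arbitrary: f rule: less_induct)
    case (less n)
    have f: "f \<in> carrier P" "\<pi> f = (0, 1)"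
      using less.prems(1) unfolding kernel_def mem_Collect_eq heisenberg_simps by blast+
    have fst0: "fst (\<theta> (f k)) = 0" if "k < m" for k
      using f(2)[THEN arg_cong, of "\<lambda>y. fst y k"] that by (simp add: \<pi>_def)
    show ?case
    proof (cases "n \<le> 1")
      case True
      have "(\<Prod>k<m. snd (\<theta> (f k))) = (\<Prod>k<m. if k = 0 then snd (\<theta> (f 0)) else 1)"
        using less.prems(2) True by (intro prod.cong refl) (auto simp: one)
      also have "\<dots> = snd (\<theta> (f 0))"
        using m by simp
      finally have "\<theta> (f 0) = \<theta> \<one>\<^bsub>H\<^esub>"
        using f(2) fst0[OF m] by (simp add: \<pi>_def one prod_eq_iff)
      then have "f 0 = \<one>\<^bsub>H\<^esub>"
        using inj carrier_P[OF f(1) m] by (auto dest: inj_onD)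
      then have "f = \<one>\<^bsub>P\<^esub>"
      proof (intro ext_P)
        fix k assume k: "k < m"
        have "f k = \<one>\<^bsub>H\<^esub>"
          using \<open>f 0 = \<one>\<^bsub>H\<^esub>\<close> less.prems(2)[OF _ k] True by (cases "k = 0") auto
        then show "f k = \<one>\<^bsub>P\<^esub> k"
          using k by (simp add: P_def)
      qed (use f(1) in simp_all)
      then show ?thesis by (simp add: generate.one)
    next
      case False
      let ?k = "n - 1"
      define s where "s = coord_embedding H m ?k (f ?k) \<otimes>\<^bsub>P\<^esub> inv\<^bsub>P\<^esub> coord_embedding H m 0 (f ?k)"
      have k: "?k < m" "?k \<noteq> 0" using False less.prems(3) by auto
      have z: "f ?k \<in> group_center H"
        using carrier_P[OF f(1) k(1)] fst0[OF k(1)] unfolding center by blast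
      then have s: "s \<in> S" unfolding S_def s_def using k(1) m by blast
      have sP: "s \<in> carrier P" using s S_P by blast
      define h where "h = f \<otimes>\<^bsub>P\<^esub> inv\<^bsub>P\<^esub> s"
      have s_k: "s i = (if i = ?k then f ?k else \<one>\<^bsub>H\<^esub>)" if "i < m" "i \<noteq> 0" for i
        using that z k unfolding s_def by (simp add: mult_P inv_P coord_P center coord)
      have "h \<in> kernel P ?L \<pi>"
        unfolding h_def
        by (rule ker.m_closed[OF less.prems(1) ker.m_inv_closed[OF subsetD[OF S_kernel s]]])
      moreover have "h i = \<one>\<^bsub>H\<^esub>" if "?k \<le> i" "i < m" for i
        using that k less.prems(2)[of i] carrier_P[OF f(1), of i]
        by (cases "i = ?k") (simp_all add: h_def mult_P inv_P sP s_k)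
      ultimately have "h \<in> generate P S"
        using less.IH[of ?k h] False less.prems(3) by simp
      then have "h \<otimes>\<^bsub>P\<^esub> s \<in> generate P S"
        using generate.incl[OF s] by (rule generate.eng)
      moreover have "h \<otimes>\<^bsub>P\<^esub> s = f"
        unfolding h_def using f(1) sP by (simp only: P.m_assoc P.inv_closed P.l_inv P.r_one)
      ultimately show ?thesis by simp
    qed
  qed
  have ker_eq: "generate P S = kernel P ?L \<pi>"
  proof
    show "generate P S \<subseteq> kernel P ?L \<pi>"
      by (rule P.generate_subgroup_incl[OF S_kernel \<pi>.subgroup_kernel])
    show "kernel P ?L \<pi> \<subseteq> generate P S"
      using gen[of _ m] by auto
  qed
  show "central_power H m \<cong> ?L"
    unfolding cp ker_eq using iso by (rule is_isoI)
  show "group (central_power H m)"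
    unfolding cp ker_eq by (rule normal.factorgroup_is_group[OF \<pi>.normal_kernel])
qed

end

section \<open>The extraspecial group of order 27\<close>

definition nat3 :: "3 \<Rightarrow> nat" where
  "nat3 a = (if a = 0 then 0 else if a = 1 then 1 else 2)"

definition log3 :: "gf4 \<Rightarrow> 3" where
  "log3 c = (if c = 1 then 0 else if c = \<omega> then 1 else - 1)"

lemma log3_psi3 [simp]: "log3 (psi3 a) = a"
  by (cases a rule: F3_cases) (auto simp: log3_def psi3_def \<omega>_def gf4_simps F3_simps)

lemma nat3_pow:
  assumes "group G" "x \<in> carrier G" "x [^]\<^bsub>G\<^esub> (3::nat) = \<one>\<^bsub>G\<^esub>"
  shows "x [^]\<^bsub>G\<^esub> nat3 (a + b) = x [^]\<^bsub>G\<^esub> nat3 a \<otimes>\<^bsub>G\<^esub> x [^]\<^bsub>G\<^esub> nat3 b"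
proof -
  interpret group G by fact
  have 3: "x [^]\<^bsub>G\<^esub> (3 + n) = x [^]\<^bsub>G\<^esub> n" for n :: nat
    using assms(2,3) nat_pow_mult[of x 3 n] by simp
  have mod3: "P (nat3 (a + b)) = P (nat3 a + nat3 b)" if "P 3 = P 0" "P 4 = P 1" for P :: "nat \<Rightarrow> 'a"
    using that by (cases a rule: F3_cases; cases b rule: F3_cases) (auto simp: nat3_def F3_simps eval_nat_numeral)
  have "x [^]\<^bsub>G\<^esub> nat3 (a + b) = x [^]\<^bsub>G\<^esub> (nat3 a + nat3 b)"
    using 3[of 0] 3[of 1] by (intro mod3) simp_all
  then show ?thesis
    using assms(2) by (simp add: nat_pow_mult)
qed

lemma heisenberg3_card: "card (carrier (heisenberg (UNIV :: (3 \<times> 3) set) form3 psi3)) = 27"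
proof -
  have "inj psi3"
    by (metis injI log3_psi3)
  then have "card (range psi3) = 3"
    by (simp add: card_image)
  then show ?thesis
    by (simp add: card_cartesian_product)
qed

text \<open>Two noncommuting elements \<open>x\<close>, \<open>y\<close> have a central commutator
  \<open>w\<close> because the quotient by the centre is abelian, and exponent 3 allows exponents in
  F_3. The relation between \<open>y x\<close> and \<open>x y w\<close> yields an injective
  homomorphism from the Heisenberg group, and both orders are 27.\<close>

lemma extraspecial_27_iso_heisenberg:
  assumes "extraspecial 3 E" and "order E = 27" and "exponent E = 3"
  shows "\<exists>\<theta>. \<theta> \<in> iso E (heisenberg (UNIV :: (3 \<times> 3) set) form3 psi3)"
proof -
  from assms(1) have "group E" and cardZ: "card (group_center E) = 3"
    and elem: "elementary_abelian 3 (E Mod group_center E)"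
    by (auto simp: extraspecial_def)
  interpret E: group E by fact
  define Z where "Z = group_center E"
  have Z_carrier: "z \<in> carrier E" if "z \<in> Z" for z
    using that by (simp add: Z_def group_center_def)
  have Z_comm: "z \<otimes>\<^bsub>E\<^esub> x = x \<otimes>\<^bsub>E\<^esub> z" if "z \<in> Z" "x \<in> carrier E" for z x
    using that by (simp add: Z_def group_center_def)
  have cube: "x [^]\<^bsub>E\<^esub> (3::nat) = \<one>\<^bsub>E\<^esub>" if x: "x \<in> carrier E" for x
  proof -
    have "E.ord x dvd Lcm (E.ord ` carrier E)"
      using x by (intro dvd_Lcm) simp
    then show ?thesis
      using assms(3) E.pow_eq_id[OF x, of 3] by (simp only: exponent_def)
  qed
  have "\<not> (\<forall>x\<in>carrier E. \<forall>y\<in>carrier E. x \<otimes>\<^bsub>E\<^esub> y = y \<otimes>\<^bsub>E\<^esub> x)"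
  proof
    assume "\<forall>x\<in>carrier E. \<forall>y\<in>carrier E. x \<otimes>\<^bsub>E\<^esub> y = y \<otimes>\<^bsub>E\<^esub> x"
    then have "group_center E = carrier E"
      by (auto simp: group_center_def)
    with cardZ assms(2) show False
      by (simp add: order_def)
  qed
  then obtain x y where x: "x \<in> carrier E" and y: "y \<in> carrier E"
    and xy: "x \<otimes>\<^bsub>E\<^esub> y \<noteq> y \<otimes>\<^bsub>E\<^esub> x" by blast
  define w where "w = inv\<^bsub>E\<^esub> (x \<otimes>\<^bsub>E\<^esub> y) \<otimes>\<^bsub>E\<^esub> (y \<otimes>\<^bsub>E\<^esub> x)"
  have w: "w \<in> carrier E" using x y by (simp add: w_def)
  have yx: "y \<otimes>\<^bsub>E\<^esub> x = x \<otimes>\<^bsub>E\<^esub> y \<otimes>\<^bsub>E\<^esub> w"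
    using x y unfolding w_def by (metis E.inv_solve_left E.inv_closed E.m_closed)
  have w_neq: "w \<noteq> \<one>\<^bsub>E\<^esub>"
    using yx xy x y by auto
  have "w \<in> Z"
  proof -
    have one_Z: "\<one>\<^bsub>E\<^esub> \<in> Z" by (simp add: Z_def group_center_def)
    have coset: "g \<in> Z #>\<^bsub>E\<^esub> g" if "g \<in> carrier E" for g
      using one_Z that by (force simp: r_coset_def)
    have "(Z #>\<^bsub>E\<^esub> y) <#>\<^bsub>E\<^esub> (Z #>\<^bsub>E\<^esub> x) = (Z #>\<^bsub>E\<^esub> x) <#>\<^bsub>E\<^esub> (Z #>\<^bsub>E\<^esub> y)"
      using elem x y comm_monoid.m_comm[OF comm_group.axioms(1), of "E Mod Z" "Z #>\<^bsub>E\<^esub> y" "Z #>\<^bsub>E\<^esub> x"]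
      by (auto simp: elementary_abelian_def Z_def FactGroup_def RCOSETS_def)
    moreover have "y \<otimes>\<^bsub>E\<^esub> x \<in> (Z #>\<^bsub>E\<^esub> y) <#>\<^bsub>E\<^esub> (Z #>\<^bsub>E\<^esub> x)"
      using coset x y by (auto simp: set_mult_def)
    ultimately obtain u v where u: "u \<in> Z" and v: "v \<in> Z"
      and eq: "y \<otimes>\<^bsub>E\<^esub> x = (u \<otimes>\<^bsub>E\<^esub> x) \<otimes>\<^bsub>E\<^esub> (v \<otimes>\<^bsub>E\<^esub> y)"
      by (auto simp: set_mult_def r_coset_def)
    have uv: "u \<in> carrier E" "v \<in> carrier E" using u v Z_carrier by auto
    have "y \<otimes>\<^bsub>E\<^esub> x = x \<otimes>\<^bsub>E\<^esub> y \<otimes>\<^bsub>E\<^esub> (u \<otimes>\<^bsub>E\<^esub> v)"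
    proof -
      have "(u \<otimes>\<^bsub>E\<^esub> x) \<otimes>\<^bsub>E\<^esub> (v \<otimes>\<^bsub>E\<^esub> y) = x \<otimes>\<^bsub>E\<^esub> (u \<otimes>\<^bsub>E\<^esub> y) \<otimes>\<^bsub>E\<^esub> v"
        unfolding Z_comm[OF u x] Z_comm[OF v y] using x y uv by (simp add: E.m_assoc)
      also have "\<dots> = x \<otimes>\<^bsub>E\<^esub> y \<otimes>\<^bsub>E\<^esub> (u \<otimes>\<^bsub>E\<^esub> v)"
        unfolding Z_comm[OF u y] using x y uv by (simp add: E.m_assoc)
      finally show ?thesis by (simp only: eq)
    qed
    then have "w = u \<otimes>\<^bsub>E\<^esub> v"
      using yx w x y uv E.l_cancel[of "x \<otimes>\<^bsub>E\<^esub> y" w "u \<otimes>\<^bsub>E\<^esub> v"] by simp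
    moreover have "u \<otimes>\<^bsub>E\<^esub> v \<in> Z"
    proof -
      have "u \<otimes>\<^bsub>E\<^esub> v \<otimes>\<^bsub>E\<^esub> g = g \<otimes>\<^bsub>E\<^esub> (u \<otimes>\<^bsub>E\<^esub> v)" if g: "g \<in> carrier E" for g
      proof -
        have "u \<otimes>\<^bsub>E\<^esub> v \<otimes>\<^bsub>E\<^esub> g = u \<otimes>\<^bsub>E\<^esub> g \<otimes>\<^bsub>E\<^esub> v"
          using uv g by (simp add: E.m_assoc Z_comm[OF v g])
        then show ?thesis
          using uv g by (simp add: E.m_assoc Z_comm[OF u g])
      qed
      then show ?thesis
        using uv by (simp add: Z_def group_center_def)
    qed
    ultimately show ?thesis by simp
  qed
  then have w_comm: "w \<otimes>\<^bsub>E\<^esub> g = g \<otimes>\<^bsub>E\<^esub> w" if "g \<in> carrier E" for g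
    using Z_comm that by simp
  have wpow_comm: "w [^]\<^bsub>E\<^esub> (n::nat) \<otimes>\<^bsub>E\<^esub> g = g \<otimes>\<^bsub>E\<^esub> w [^]\<^bsub>E\<^esub> n" if "g \<in> carrier E" for g n
    by (rule E.group_commutes_pow[OF w_comm[OF that] w that])
  have y_xpow: "y \<otimes>\<^bsub>E\<^esub> x [^]\<^bsub>E\<^esub> (n::nat) = x [^]\<^bsub>E\<^esub> n \<otimes>\<^bsub>E\<^esub> y \<otimes>\<^bsub>E\<^esub> w [^]\<^bsub>E\<^esub> n" for n
  proof (induction n)
    case (Suc n)
    have "y \<otimes>\<^bsub>E\<^esub> x [^]\<^bsub>E\<^esub> Suc n = (y \<otimes>\<^bsub>E\<^esub> x [^]\<^bsub>E\<^esub> n) \<otimes>\<^bsub>E\<^esub> x"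
      using x y by (simp add: E.m_assoc)
    also have "\<dots> = x [^]\<^bsub>E\<^esub> n \<otimes>\<^bsub>E\<^esub> y \<otimes>\<^bsub>E\<^esub> (w [^]\<^bsub>E\<^esub> n \<otimes>\<^bsub>E\<^esub> x)"
      unfolding Suc using x y w by (simp add: E.m_assoc)
    also have "\<dots> = x [^]\<^bsub>E\<^esub> n \<otimes>\<^bsub>E\<^esub> (y \<otimes>\<^bsub>E\<^esub> x) \<otimes>\<^bsub>E\<^esub> w [^]\<^bsub>E\<^esub> n"
      unfolding wpow_comm[OF x] using x y w by (simp add: E.m_assoc)
    also have "\<dots> = x [^]\<^bsub>E\<^esub> Suc n \<otimes>\<^bsub>E\<^esub> y \<otimes>\<^bsub>E\<^esub> (w \<otimes>\<^bsub>E\<^esub> w [^]\<^bsub>E\<^esub> n)"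
      unfolding yx using x y w by (simp add: E.m_assoc)
    also have "w \<otimes>\<^bsub>E\<^esub> w [^]\<^bsub>E\<^esub> n = w [^]\<^bsub>E\<^esub> Suc n"
      using w by (simp add: w_comm)
    finally show ?case .
  qed (use x y in simp)
  have ypow_xpow: "y [^]\<^bsub>E\<^esub> (k::nat) \<otimes>\<^bsub>E\<^esub> x [^]\<^bsub>E\<^esub> n = x [^]\<^bsub>E\<^esub> n \<otimes>\<^bsub>E\<^esub> y [^]\<^bsub>E\<^esub> k \<otimes>\<^bsub>E\<^esub> w [^]\<^bsub>E\<^esub> (n * k)"
    for n k :: nat
  proof (induction k)
    case (Suc k)
    have "y [^]\<^bsub>E\<^esub> Suc k \<otimes>\<^bsub>E\<^esub> x [^]\<^bsub>E\<^esub> n = y [^]\<^bsub>E\<^esub> k \<otimes>\<^bsub>E\<^esub> (y \<otimes>\<^bsub>E\<^esub> x [^]\<^bsub>E\<^esub> n)"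
      using x y by (simp add: E.m_assoc)
    also have "\<dots> = (y [^]\<^bsub>E\<^esub> k \<otimes>\<^bsub>E\<^esub> x [^]\<^bsub>E\<^esub> n) \<otimes>\<^bsub>E\<^esub> y \<otimes>\<^bsub>E\<^esub> w [^]\<^bsub>E\<^esub> n"
      unfolding y_xpow using x y w by (simp add: E.m_assoc)
    also have "\<dots> = x [^]\<^bsub>E\<^esub> n \<otimes>\<^bsub>E\<^esub> y [^]\<^bsub>E\<^esub> k \<otimes>\<^bsub>E\<^esub> (w [^]\<^bsub>E\<^esub> (n * k) \<otimes>\<^bsub>E\<^esub> y) \<otimes>\<^bsub>E\<^esub> w [^]\<^bsub>E\<^esub> n"
      unfolding Suc using x y w by (simp add: E.m_assoc)
    also have "\<dots> = x [^]\<^bsub>E\<^esub> n \<otimes>\<^bsub>E\<^esub> y [^]\<^bsub>E\<^esub> Suc k \<otimes>\<^bsub>E\<^esub> (w [^]\<^bsub>E\<^esub> (n * k) \<otimes>\<^bsub>E\<^esub> w [^]\<^bsub>E\<^esub> n)"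
      unfolding wpow_comm[OF y] using x y w by (simp add: E.m_assoc)
    also have "w [^]\<^bsub>E\<^esub> (n * k) \<otimes>\<^bsub>E\<^esub> w [^]\<^bsub>E\<^esub> n = w [^]\<^bsub>E\<^esub> (n * Suc k)"
      using w by (simp add: E.nat_pow_mult add.commute)
    finally show ?case .
  qed (use x y in simp)
  let ?x = "\<lambda>a. x [^]\<^bsub>E\<^esub> nat3 a" and ?y = "\<lambda>a. y [^]\<^bsub>E\<^esub> nat3 a" and ?w = "\<lambda>a. w [^]\<^bsub>E\<^esub> nat3 a"
  note add = nat3_pow[OF \<open>group E\<close>]
  have wmod: "w [^]\<^bsub>E\<^esub> (nat3 a * nat3 b) = ?w (a * b)" for a b
  proof -
    have "w [^]\<^bsub>E\<^esub> (4::nat) = w [^]\<^bsub>E\<^esub> (3::nat) \<otimes>\<^bsub>E\<^esub> w [^]\<^bsub>E\<^esub> (1::nat)"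
      using w by (simp only: E.nat_pow_mult) simp
    then have "w [^]\<^bsub>E\<^esub> (4::nat) = w [^]\<^bsub>E\<^esub> (1::nat)"
      using w by (simp add: cube)
    moreover have "P (nat3 a * nat3 b) = P (nat3 (a * b))" if "P 4 = P 1" for P :: "nat \<Rightarrow> 'a"
      using that by (cases a rule: F3_cases; cases b rule: F3_cases)
        (auto simp: nat3_def F3_simps eval_nat_numeral)
    ultimately show ?thesis
      by blast
  qed
  have comm: "?y b \<otimes>\<^bsub>E\<^esub> ?x a = ?x a \<otimes>\<^bsub>E\<^esub> ?y b \<otimes>\<^bsub>E\<^esub> ?w (a * b)" for a b
    by (simp add: ypow_xpow wmod)
  have w1: "a = 0" if "?w a = \<one>\<^bsub>E\<^esub>" for a
  proof (cases a rule: F3_cases)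
    case 2
    with that w_neq w show ?thesis by (simp add: nat3_def)
  next
    case 3
    have "w = w [^]\<^bsub>E\<^esub> (3::nat) \<otimes>\<^bsub>E\<^esub> inv\<^bsub>E\<^esub> (w [^]\<^bsub>E\<^esub> (2::nat))"
      using w by (simp add: numeral_3_eq_3 numeral_2_eq_2) (metis E.m_assoc E.inv_closed E.r_inv E.r_one E.m_closed w_comm)
    with that w_neq w 3 show ?thesis by (simp add: nat3_def F3_simps cube)
  qed
  let ?K = "heisenberg (UNIV :: (3 \<times> 3) set) form3 psi3"
  interpret K: group ?K
    by (rule bicharacter.heisenberg_group[OF plane3.bicharacter_plane])
  \<comment> \<open>Multiplying normal forms adds \<open>c * b\<close> to the exponent of
    \<open>w\<close>, whereas the form adds \<open>c * b - a * d\<close>. Solving for the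
    coefficients of \<open>log3 s\<close> and \<open>a * b\<close> gives 1/2 for both, which is -1
    in F_3.\<close>
  define F where "F = (\<lambda>((a, b), s). ?x a \<otimes>\<^bsub>E\<^esub> ?y b \<otimes>\<^bsub>E\<^esub> ?w (- (log3 s + a * b)))"
  have "F \<in> hom ?K E"
  proof (rule homI)
    fix k l assume "k \<in> carrier ?K" "l \<in> carrier ?K"
    then obtain a b s c d t where k: "k = ((a, b), psi3 s)" and l: "l = ((c, d), psi3 t)"
      by (auto; force)
    have e: "- (s + t + (c * b - a * d) + (a + c) * (b + d)) = c * b + - (s + a * b) + - (t + c * d)"
    proof -
      have "- (s + t + (c * b - a * d) + (a + c) * (b + d)) - (c * b + - (s + a * b) + - (t + c * d)) =
          3 * (- (b * c))"
        by (simp add: algebra_simps)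
      also have "\<dots> = 0" using F3_3 by (simp only: mult_zero_left)
      finally show ?thesis by (rule eq_iff_diff_eq_0[THEN iffD2])
    qed
    have "F (k \<otimes>\<^bsub>?K\<^esub> l) = ?x (a + c) \<otimes>\<^bsub>E\<^esub> ?y (b + d) \<otimes>\<^bsub>E\<^esub> ?w (c * b + - (s + a * b) + - (t + c * d))"
      unfolding e[symmetric] by (simp add: F_def k l psi3_add[symmetric] algebra_simps)
    also have "\<dots> = ?x a \<otimes>\<^bsub>E\<^esub> (?x c \<otimes>\<^bsub>E\<^esub> ?y b \<otimes>\<^bsub>E\<^esub> (?y d \<otimes>\<^bsub>E\<^esub> ?w (c * b))) \<otimes>\<^bsub>E\<^esub> ?w (- (s + a * b)) \<otimes>\<^bsub>E\<^esub> ?w (- (t + c * d))"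
      using x y w by (simp add: add cube E.m_assoc)
    also have "\<dots> = ?x a \<otimes>\<^bsub>E\<^esub> (?x c \<otimes>\<^bsub>E\<^esub> ?y b \<otimes>\<^bsub>E\<^esub> ?w (c * b)) \<otimes>\<^bsub>E\<^esub> (?y d \<otimes>\<^bsub>E\<^esub> ?w (- (s + a * b))) \<otimes>\<^bsub>E\<^esub> ?w (- (t + c * d))"
      unfolding wpow_comm[OF E.nat_pow_closed[OF y], symmetric, of "nat3 d" "nat3 (c * b)"]
      using x y w by (simp add: E.m_assoc)
    also have "\<dots> = ?x a \<otimes>\<^bsub>E\<^esub> (?y b \<otimes>\<^bsub>E\<^esub> ?x c) \<otimes>\<^bsub>E\<^esub> (?w (- (s + a * b)) \<otimes>\<^bsub>E\<^esub> ?y d) \<otimes>\<^bsub>E\<^esub> ?w (- (t + c * d))"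
      using y by (simp only: comm wpow_comm E.nat_pow_closed)
    also have "\<dots> = ?x a \<otimes>\<^bsub>E\<^esub> ?y b \<otimes>\<^bsub>E\<^esub> (?w (- (s + a * b)) \<otimes>\<^bsub>E\<^esub> ?x c) \<otimes>\<^bsub>E\<^esub> ?y d \<otimes>\<^bsub>E\<^esub> ?w (- (t + c * d))"
      unfolding wpow_comm[OF E.nat_pow_closed[OF x], of "nat3 (- (s + a * b))" "nat3 c"]
      using x y w by (simp add: E.m_assoc)
    also have "\<dots> = F k \<otimes>\<^bsub>E\<^esub> F l"
      using x y w by (simp add: F_def k l E.m_assoc)
    finally show "F (k \<otimes>\<^bsub>?K\<^esub> l) = F k \<otimes>\<^bsub>E\<^esub> F l" .
  qed (use x y w in \<open>auto simp: F_def\<close>)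
  then interpret F: group_hom ?K E F
    by (simp add: group_hom_def group_hom_axioms_def K.is_group E.is_group)
  have inj: "inj_on F (carrier ?K)"
  proof (rule F.inj_on_one_iff[THEN iffD2], intro allI impI)
    fix k assume "k \<in> carrier ?K" and Fk: "F k = \<one>\<^bsub>E\<^esub>"
    then obtain a b s where k: "k = ((a, b), psi3 s)" by (auto; force)
    define c where "c = - (s + a * b)"
    have 1: "?x a \<otimes>\<^bsub>E\<^esub> ?y b \<otimes>\<^bsub>E\<^esub> ?w c = \<one>\<^bsub>E\<^esub>"
      using Fk by (simp add: F_def k c_def)
    \<comment> \<open>An element equal to 1 commutes with \<open>y\<close> and \<open>x\<close>:
      moving \<open>y\<close> past it leaves the factor \<open>?w a\<close>, and moving
      \<open>x\<close> past the rest leaves \<open>?w b\<close>, so both exponents vanish.\<close>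
    have "?y 1 = ?y 1 \<otimes>\<^bsub>E\<^esub> (?x a \<otimes>\<^bsub>E\<^esub> ?y b \<otimes>\<^bsub>E\<^esub> ?w c)"
      using y by (simp add: 1)
    also have "\<dots> = (?y 1 \<otimes>\<^bsub>E\<^esub> ?x a) \<otimes>\<^bsub>E\<^esub> (?y b \<otimes>\<^bsub>E\<^esub> ?w c)"
      using x y w by (simp add: E.m_assoc)
    also have "\<dots> = ?x a \<otimes>\<^bsub>E\<^esub> ?y 1 \<otimes>\<^bsub>E\<^esub> (?w a \<otimes>\<^bsub>E\<^esub> (?y b \<otimes>\<^bsub>E\<^esub> ?w c))"
      unfolding comm using x y w by (simp add: E.m_assoc)
    also have "\<dots> = ?x a \<otimes>\<^bsub>E\<^esub> (?y 1 \<otimes>\<^bsub>E\<^esub> ?y b) \<otimes>\<^bsub>E\<^esub> (?w c \<otimes>\<^bsub>E\<^esub> ?w a)"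
      using x y w wpow_comm[of "?y b \<otimes>\<^bsub>E\<^esub> ?w c" "nat3 a"] by (simp add: E.m_assoc)
    also have "\<dots> = ?x a \<otimes>\<^bsub>E\<^esub> ?y b \<otimes>\<^bsub>E\<^esub> (?y 1 \<otimes>\<^bsub>E\<^esub> ?w c) \<otimes>\<^bsub>E\<^esub> ?w a"
      using x y w E.nat_pow_comm[OF y, of "nat3 1" "nat3 b"] by (simp add: E.m_assoc)
    also have "\<dots> = (?x a \<otimes>\<^bsub>E\<^esub> ?y b \<otimes>\<^bsub>E\<^esub> ?w c) \<otimes>\<^bsub>E\<^esub> ?y 1 \<otimes>\<^bsub>E\<^esub> ?w a"
      unfolding wpow_comm[OF E.nat_pow_closed[OF y], symmetric, of "nat3 1" "nat3 c"]
      using x y w by (simp add: E.m_assoc)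
    finally have "?w a = \<one>\<^bsub>E\<^esub>"
      using y w by (simp add: 1)
    then have a: "a = 0" by (rule w1)
    then have 2: "?y b \<otimes>\<^bsub>E\<^esub> ?w c = \<one>\<^bsub>E\<^esub>"
      using 1 y by (simp add: nat3_def)
    have "?x 1 = ?y b \<otimes>\<^bsub>E\<^esub> ?w c \<otimes>\<^bsub>E\<^esub> ?x 1"
      using x by (simp add: 2)
    also have "\<dots> = (?y b \<otimes>\<^bsub>E\<^esub> ?x 1) \<otimes>\<^bsub>E\<^esub> ?w c"
      using x y w wpow_comm[of "?x 1" "nat3 c"] by (simp add: E.m_assoc)
    also have "\<dots> = ?x 1 \<otimes>\<^bsub>E\<^esub> ?y b \<otimes>\<^bsub>E\<^esub> (?w b \<otimes>\<^bsub>E\<^esub> ?w c)"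
      unfolding comm using x y w by (simp add: E.m_assoc)
    also have "\<dots> = ?x 1 \<otimes>\<^bsub>E\<^esub> (?y b \<otimes>\<^bsub>E\<^esub> ?w c) \<otimes>\<^bsub>E\<^esub> ?w b"
      using x y w wpow_comm[of "?w c" "nat3 b"] by (simp add: E.m_assoc)
    finally have "?w b = \<one>\<^bsub>E\<^esub>"
      using x w by (simp add: 2)
    then have b: "b = 0" by (rule w1)
    have "?w c = \<one>\<^bsub>E\<^esub>"
      using 2 b w by (simp add: nat3_def)
    then have "- (s + a * b) = 0" unfolding c_def by (rule w1)
    then show "k = \<one>\<^bsub>?K\<^esub>"
      by (simp add: k a b zero_prod_def psi3_def)
  qed
  have "card (F ` carrier ?K) = 27"
    using card_image[OF inj] heisenberg3_card by simp
  then have "F ` carrier ?K = carrier E"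
    using assms(2) F.hom_closed
    by (intro card_subset_eq) (auto simp: order_def card_ge_0_finite)
  then have "F \<in> iso ?K E"
    using F.homh inj by (simp add: iso_def bij_betw_def)
  then show ?thesis
    using K.iso_set_sym by blast
qed

section \<open>The quaternion group and the symplectic group\<close>

text \<open>Up to sign, 1, i, j, k lie over 0, 1, \<open>\<omega>\<close> and its square. The
  central sign is reversed for i, j, k; otherwise the cocycle would make the product of i and j
  equal to -k.\<close>

lemma quaternion_group_iso_heisenberg:
  "\<exists>\<theta>. \<theta> \<in> iso quaternion_group (heisenberg (UNIV :: gf4 set) form4 psi4)"
proof -
  define \<theta> :: "int \<times> int \<times> int \<times> int \<Rightarrow> gf4 \<times> 3" where
    "\<theta> = (\<lambda>(a, b, c, d). (GF4 (b \<noteq> 0 \<or> d \<noteq> 0) (c \<noteq> 0 \<or> d \<noteq> 0), of_int (a - b - c - d)))"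
  have range: "range psi4 = {1, - 1}"
    unfolding gf4_UNIV by auto
  have "\<theta> \<in> hom quaternion_group (heisenberg UNIV form4 psi4)"
  proof (rule homI)
    fix x y assume "x \<in> carrier quaternion_group" "y \<in> carrier quaternion_group"
    then show "\<theta> (x \<otimes>\<^bsub>quaternion_group\<^esub> y) = \<theta> x \<otimes>\<^bsub>heisenberg UNIV form4 psi4\<^esub> \<theta> y"
      by (auto simp: quaternion_group_def \<theta>_def form4_def F3_simps)
  qed (auto simp: quaternion_group_def \<theta>_def range)
  moreover have "bij_betw \<theta> (carrier quaternion_group) (carrier (heisenberg UNIV form4 psi4))"
    unfolding bij_betw_def
    by (auto simp: inj_on_def quaternion_group_def \<theta>_def range F3_simps gf4_UNIV)
  ultimately show ?thesis
    by (auto simp: iso_def)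
qed

text \<open>In degree 2 a matrix multiplies the symplectic form by its determinant.\<close>

lemma Sp2_carrier:
  "A \<in> carrier (Sp2 :: ('a::comm_ring_1 ^ 2 ^ 2) monoid) \<longleftrightarrow>
     A $ 1 $ 1 * A $ 2 $ 2 - A $ 1 $ 2 * A $ 2 $ 1 = 1"
  by (auto simp: Sp2_def symplectic_gram_def vec_eq_iff forall_2 sum_2 matrix_matrix_mult_def
      transpose_def algebra_simps)

lemma Sp2_group: "group (Sp2 :: ('a::comm_ring_1 ^ 2 ^ 2) monoid)"
proof (rule groupI)
  fix A :: "'a ^ 2 ^ 2" assume A: "A \<in> carrier Sp2"
  let ?B = "vector [vector [A $ 2 $ 2, - A $ 1 $ 2], vector [- A $ 2 $ 1, A $ 1 $ 1]] :: 'a ^ 2 ^ 2"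
  have "?B \<in> carrier Sp2"
    using A by (simp add: Sp2_carrier algebra_simps)
  moreover have "?B \<otimes>\<^bsub>Sp2\<^esub> A = \<one>\<^bsub>Sp2\<^esub>"
    using A unfolding Sp2_carrier
    by (simp add: Sp2_def vec_eq_iff forall_2 sum_2 matrix_matrix_mult_def mat_def algebra_simps)
  ultimately show "\<exists>B\<in>carrier Sp2. B \<otimes>\<^bsub>Sp2\<^esub> A = \<one>\<^bsub>Sp2\<^esub>"
    by blast
next
  fix A B :: "'a ^ 2 ^ 2" assume AB: "A \<in> carrier Sp2" "B \<in> carrier Sp2"
  let ?J = "symplectic_gram :: 'a ^ 2 ^ 2"
  have "transpose (A ** B) ** ?J ** (A ** B) = transpose B ** (transpose A ** ?J ** A) ** B"
    by (simp only: matrix_transpose_mul matrix_mul_assoc)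
  then show "A \<otimes>\<^bsub>Sp2\<^esub> B \<in> carrier Sp2"
    using AB by (simp add: Sp2_def)
qed (auto simp: Sp2_def matrix_mul_assoc transpose_mat)

text \<open>The initial space is F_3^2, sitting at coordinate 0; a matrix multiplies
  \<open>form3\<close> by its determinant, which is 1.\<close>

lemma Sp2_isometric_action:
  "\<exists>a. isometric_action (Sp2 :: (3 ^ 2 ^ 2) monoid) (funs_below 1) (sum_form form3 1)
     (\<lambda>v k. - v k) a"
proof
  define a :: "3 ^ 2 ^ 2 \<Rightarrow> (nat \<Rightarrow> 3 \<times> 3) \<Rightarrow> nat \<Rightarrow> 3 \<times> 3" where
    "a A v k = (A $ 1 $ 1 * fst (v k) + A $ 1 $ 2 * snd (v k),
      A $ 2 $ 1 * fst (v k) + A $ 2 $ 2 * snd (v k))" for A v k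
  have form: "form3 u v = fst v * snd u - fst u * snd v" for u v
    by (cases u; cases v) simp
  show "isometric_action Sp2 (funs_below 1) (sum_form form3 1) (\<lambda>v k. - v k) a"
    unfolding isometric_action_def
  proof (intro conjI ballI)
    fix A :: "3 ^ 2 ^ 2" assume "A \<in> carrier Sp2"
    then have det: "A $ 1 $ 1 * A $ 2 $ 2 - A $ 1 $ 2 * A $ 2 $ 1 = 1"
      by (simp add: Sp2_carrier)
    have "form3 (a A v k) (a A w k) = (A $ 1 $ 1 * A $ 2 $ 2 - A $ 1 $ 2 * A $ 2 $ 1) * form3 (v k) (w k)"
      for v w k
      by (simp add: form a_def algebra_simps)
    then show "isometry (funs_below 1) (sum_form form3 1) (\<lambda>v k. - v k) (a A)"
      unfolding det
      by (auto simp: isometry_def sum_form_def) (auto simp: a_def funs_below_def fun_eq_iff zero_prod_def algebra_simps)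
  next
    fix v :: "nat \<Rightarrow> 3 \<times> 3"
    show "a \<one>\<^bsub>Sp2\<^esub> v = v"
      by (auto simp: a_def Sp2_def mat_def)
  next
    fix A B v
    show "a (A \<otimes>\<^bsub>Sp2\<^esub> B) v = a A (a B v)"
      by (auto simp: a_def Sp2_def matrix_matrix_mult_def sum_2 algebra_simps fun_eq_iff)
  next
    show "faithful_on Sp2 a (funs_below 1)"
      unfolding faithful_on_def
    proof (intro ballI impI)
      fix A :: "3 ^ 2 ^ 2"
      assume triv: "\<forall>v\<in>funs_below 1. a A v = v"
      have "a A (\<lambda>k. if k = 0 then u else 0) 0 = u" for u
        using bspec[OF triv, of "\<lambda>k. if k = 0 then u else 0"]
        by (simp add: funs_below_def)
      from this[of "(1, 0)"] this[of "(0, 1)"] show "A = \<one>\<^bsub>Sp2\<^esub>"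
        by (simp add: a_def Sp2_def vec_eq_iff forall_2 mat_def)
    qed
  qed
qed

text \<open>Moves the action from tensors to the coordinates in which the next Heisenberg group is
  written.\<close>

lemma isometric_action_transport:
  assumes act: "isometric_action G V \<beta> \<tau> a"
    and bij: "bij_betw \<Phi> V V'"
    and closed: "\<And>v w. v \<in> V \<Longrightarrow> w \<in> V \<Longrightarrow> v + w \<in> V" "\<And>v. v \<in> V \<Longrightarrow> \<tau> v \<in> V"
    and add: "\<And>v w. v \<in> V \<Longrightarrow> w \<in> V \<Longrightarrow> \<Phi> (v + w) = \<Phi> v + \<Phi> w"
    and form: "\<And>v w. v \<in> V \<Longrightarrow> w \<in> V \<Longrightarrow> \<beta>' (\<Phi> v) (\<Phi> w) = \<beta> v w"
    and \<tau>: "\<And>v. v \<in> V \<Longrightarrow> \<Phi> (\<tau> v) = \<tau>' (\<Phi> v)"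
  shows "isometric_action G V' \<beta>' \<tau>' (\<lambda>g v'. \<Phi> (a g (inv_into V \<Phi> v')))"
proof -
  have V': "V' = \<Phi> ` V" using bij by (simp add: bij_betw_def)
  have inv: "inv_into V \<Phi> (\<Phi> v) = v" if "v \<in> V" for v
    using bij that by (rule bij_betw_inv_into_left)
  have a: "a g v \<in> V" "a g (\<tau> v) = \<tau> (a g v)" if "g \<in> carrier G" "v \<in> V" for g v
    using act that by (auto simp: isometric_action_def isometry_def)
  have a2: "a g (v + w) = a g v + a g w" "\<beta> (a g v) (a g w) = \<beta> v w"
    if "g \<in> carrier G" "v \<in> V" "w \<in> V" for g v w
    using act that by (auto simp: isometric_action_def isometry_def)
  have a3: "a \<one>\<^bsub>G\<^esub> v = v" if "v \<in> V" for v
    using act that by (auto simp: isometric_action_def)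
  have a4: "a (g \<otimes>\<^bsub>G\<^esub> h) v = a g (a h v)" if "g \<in> carrier G" "h \<in> carrier G" "v \<in> V" for g h v
    using act that by (auto simp: isometric_action_def)
  show ?thesis
    unfolding isometric_action_def V'
  proof (intro conjI ballI)
    fix g assume g: "g \<in> carrier G"
    show "isometry (\<Phi> ` V) \<beta>' \<tau>' (\<lambda>v'. \<Phi> (a g (inv_into V \<Phi> v')))"
      using g by (auto simp: isometry_def inv a a2 form add[symmetric] closed \<tau>[symmetric])
  next
    show "faithful_on G (\<lambda>g v'. \<Phi> (a g (inv_into V \<Phi> v'))) (\<Phi> ` V)"
      unfolding faithful_on_def
    proof (intro ballI impI)
      fix g assume g: "g \<in> carrier G" and triv: "\<forall>x\<in>\<Phi> ` V. \<Phi> (a g (inv_into V \<Phi> x)) = x"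
      have "a g v = v" if "v \<in> V" for v
        using triv inv[OF that] inv[OF a(1)[OF g that]] that by force
      then show "g = \<one>\<^bsub>G\<^esub>"
        using act g by (auto simp: isometric_action_def faithful_on_def)
    qed
  qed (auto simp: inv a a3 a4)
qed

section \<open>The iterated extension\<close>

text \<open>An invariant of the recursion; finiteness allows the next group to be copied onto
  naturals.\<close>

definition heis3_stage :: "nat \<Rightarrow> nat monoid \<Rightarrow> bool" where
  "heis3_stage m G \<longleftrightarrow> group G \<and> finite (carrier G) \<and>
     (\<exists>a. isometric_action G (funs_below m) (sum_form form3 m) (\<lambda>v k. - v k) a)"

definition heis4_stage :: "nat \<Rightarrow> nat monoid \<Rightarrow> bool" where
  "heis4_stage m G \<longleftrightarrow> group G \<and> finite (carrier G) \<and>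
     (\<exists>a. isometric_action G (funs_below m) (sum_form form4 m) (\<lambda>v k. \<omega> * v k) a)"

section \<open>The tensor powers as standard hermitian and symplectic spaces\<close>

lemma card_words: "card (words m :: (nat \<Rightarrow> 'x::finite) set) = CARD('x) ^ m"
  by (simp add: card_PiE)

text \<open>The Gram matrix of one factor is the identity, so the tensor form is the standard
  hermitian form in the basis of words; \<open>\<Phi>\<close> merely enumerates the words.\<close>

lemma tensors3_isometry:
  "\<exists>\<Phi>. bij_betw \<Phi> (plane3.tensors m) (funs_below (3 ^ m)) \<and>
     (\<forall>f g. \<Phi> (f + g) = \<Phi> f + \<Phi> g) \<and>
     (\<forall>f g. sum_form form4 (3 ^ m) (\<Phi> f) (\<Phi> g) = plane3.tensor_form m f g) \<and>
     (\<forall>f. \<Phi> (\<lambda>x. \<omega> * f x) = (\<lambda>k. \<omega> * \<Phi> f k))"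
proof -
  let ?W = "words m :: (nat \<Rightarrow> 3) set"
  have "card ?W = 3 ^ m" by (simp add: card_words)
  then obtain e where e: "bij_betw e {..<(3::nat) ^ m} ?W"
    using ex_bij_betw_nat_finite[OF plane3.finite_words[of m]] by (auto simp: atLeast0LessThan)
  define e' where "e' = inv_into {..<3 ^ m} e"
  have e'e: "e' (e k) = k" if "k < 3 ^ m" for k
    using e that unfolding e'_def by (simp add: bij_betw_inv_into_left)
  have ee': "e (e' x) = x" "e' x < 3 ^ m" if "x \<in> ?W" for x
    using e that bij_betw_inv_into_right[OF e that] bij_betw_apply[OF bij_betw_inv_into[OF e] that]
    unfolding e'_def by simp_all
  have eW: "e k \<in> ?W" if "k < 3 ^ m" for k
    using bij_betw_apply[OF e] that by simp
  define \<Phi> where "\<Phi> f = (\<lambda>k. if k < 3 ^ m then f (e k) else 0)" for f :: "(nat \<Rightarrow> 3) \<Rightarrow> gf4"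
  have "bij_betw \<Phi> (plane3.tensors m) (funs_below (3 ^ m))"
    by (rule bij_betwI[of _ _ _ "\<lambda>v x. if x \<in> ?W then v (e' x) else 0"])
       (auto simp: \<Phi>_def plane3.tensors_def funs_below_def fun_eq_iff e'e ee' eW)
  moreover have "sum_form form4 (3 ^ m) (\<Phi> f) (\<Phi> g) = plane3.tensor_form m f g" for f g
  proof -
    have C: "plane3.C m x y = (if x = y then 1 else 0)" if xy: "x \<in> ?W" "y \<in> ?W" for x y
    proof (cases "x = y")
      case False
      then obtain k where "k < m" "x k \<noteq> y k"
        using words_eq_iff[OF xy] by blast
      then have "(\<Prod>k<m. if x k = y k then 1 else 0 :: gf4) = 0"
        by (intro prod_zero) auto
      with False show ?thesis by (simp add: plane3.C_def)
    qed (simp add: plane3.C_def)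
    have "plane3.tensor_form m f g = (\<Sum>x\<in>?W. \<Sum>y\<in>?W. if x = y then f x * gf4_conj (g y) else 0)"
      unfolding plane3.tensor_form_def by (intro sum.cong refl) (simp add: C)
    also have "\<dots> = (\<Sum>x\<in>?W. f x * gf4_conj (g x))"
      by (simp add: plane3.finite_words)
    also have "\<dots> = (\<Sum>k<3 ^ m. f (e k) * gf4_conj (g (e k)))"
      using sum.reindex_bij_betw[OF e, of "\<lambda>x. f x * gf4_conj (g x)"] by simp
    also have "\<dots> = sum_form form4 (3 ^ m) (\<Phi> f) (\<Phi> g)"
      by (simp add: sum_form_def form4_def \<Phi>_def)
    finally show ?thesis by simp
  qed
  moreover have "\<Phi> (f + g) = \<Phi> f + \<Phi> g" "\<Phi> (\<lambda>x. \<omega> * f x) = (\<lambda>k. \<omega> * \<Phi> f k)" for f g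
    by (auto simp: \<Phi>_def fun_eq_iff)
  ultimately show ?thesis by blast
qed

text \<open>For odd \<open>m\<close> the form is alternating; a hyperbolic basis pairs each word with its complement.\<close>
lemma tensors4_isometry:
  assumes "odd m"
  shows "\<exists>\<Phi>. bij_betw \<Phi> (plane4.tensors m) (funs_below (2 ^ (m - 1))) \<and>
     (\<forall>f g. \<Phi> (f + g) = \<Phi> f + \<Phi> g) \<and>
     (\<forall>f g. sum_form form3 (2 ^ (m - 1)) (\<Phi> f) (\<Phi> g) = plane4.tensor_form m f g) \<and>
     (\<forall>f. \<Phi> (\<lambda>x. - 1 * f x) = (\<lambda>k. - \<Phi> f k))"
proof -
  let ?W = "words m :: (nat \<Rightarrow> bool) set" and ?n = "2 ^ (m - 1) :: nat"
  have m: "0 < m" using assms by (cases m) auto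
  \<comment> \<open>\<open>Y\<close> picks from each pair of complementary words the one with first
    letter \<open>False\<close>, so it holds half of the 2^m words.\<close>
  define Y where "Y = {x \<in> ?W. \<not> x 0}"
  define co where "co x = (\<lambda>k\<in>{..<m}. \<not> x k)" for x :: "nat \<Rightarrow> bool"
  have co_W [simp]: "co x \<in> ?W" for x by (simp add: co_def)
  have co_co: "co (co x) = x" if "x \<in> ?W" for x
    using words_eq_iff[OF co_W that, of "co x"] by (simp add: co_def)
  have co_Y: "co x \<notin> Y \<longleftrightarrow> x \<in> Y" if "x \<in> ?W" for x
    using that m by (simp add: Y_def) (simp add: co_def)
  have Y_W: "Y \<subseteq> ?W" by (auto simp: Y_def)
  have fin: "finite Y" using Y_W plane4.finite_words finite_subset by blast
  have bij_co: "bij_betw co Y (?W - Y)"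
  proof (rule bij_betwI[of _ _ _ co])
    show "co \<in> Y \<rightarrow> ?W - Y"
    proof
      fix x assume "x \<in> Y"
      with co_Y[OF subsetD[OF Y_W this]] show "co x \<in> ?W - Y" by (simp del: PiE_iff)
    qed
    show "co \<in> ?W - Y \<rightarrow> Y"
    proof
      fix x assume "x \<in> ?W - Y"
      then show "co x \<in> Y" using co_Y[of x] by blast
    qed
    show "co (co x) = x" if "x \<in> Y" for x
      using co_co subsetD[OF Y_W that] by simp
    show "co (co x) = x" if "x \<in> ?W - Y" for x
      using co_co[OF DiffD1[OF that]] .
  qed
  have "card Y + card (?W - Y) = card ?W"
    using card_Diff_subset[OF fin Y_W] card_mono[OF plane4.finite_words Y_W] by simp
  then have "2 * card Y = 2 ^ m"
    using bij_betw_same_card[OF bij_co] by (simp add: card_words)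
  also have "\<dots> = 2 * 2 ^ (m - 1)"
    using m by (metis Suc_diff_1 power_Suc)
  finally have "card Y = ?n" by simp
  then obtain e where e: "bij_betw e {..<?n} Y"
    using ex_bij_betw_nat_finite[OF fin] by (auto simp: atLeast0LessThan)
  define e' where "e' = inv_into {..<?n} e"
  have e'e: "e' (e k) = k" if "k < ?n" for k
    using e that unfolding e'_def by (simp add: bij_betw_inv_into_left)
  have ee': "e (e' x) = x" "e' x < ?n" if "x \<in> Y" for x
    using e that bij_betw_inv_into_right[OF e that] bij_betw_apply[OF bij_betw_inv_into[OF e] that]
    unfolding e'_def by simp_all
  have eY: "e k \<in> Y" if "k < ?n" for k
    using bij_betw_apply[OF e] that by simp
  have eW: "e k \<in> ?W" if "k < ?n" for k
    using eY[OF that] Y_W by blast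
  define s where "s x = plane4.C m x (co x)" for x
  have s: "s x = (\<Prod>k<m. if x k then - 1 else 1)" for x
    unfolding s_def plane4.C_def by (intro prod.cong refl) (simp add: co_def alt2_def)
  have ss: "s x * s x = 1" for x
    unfolding s prod.distrib[symmetric] by (intro prod.neutral) simp
  \<comment> \<open>Complementing reverses each of the \<open>m\<close> signs; as \<open>m\<close>
    is odd, the form becomes alternating.\<close>
  have s_co: "s (co x) = - s x" for x
  proof -
    have "s (co x) = (\<Prod>k<m. - 1 * (if x k then - 1 else 1))"
      unfolding s by (intro prod.cong refl) (simp add: co_def)
    also have "\<dots> = (- 1) ^ m * s x"
      unfolding prod.distrib s by simp
    finally show ?thesis using assms by simp
  qed
  \<comment> \<open>Each complementary pair spans a hyperbolic plane. The Gram entry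
    \<open>s\<close>, its own inverse, is absorbed into one coordinate, and the order of the two
    fits the sign of \<open>form3\<close>.\<close>
  define \<Phi> where "\<Phi> f = (\<lambda>k. if k < ?n then (f (co (e k)), s (e k) * f (e k)) else 0)"
    for f :: "(nat \<Rightarrow> bool) \<Rightarrow> 3"
  define \<Psi> where "\<Psi> v = (\<lambda>x. if x \<in> Y then s x * snd (v (e' x)) else
      if x \<in> ?W then fst (v (e' (co x))) else 0)" for v :: "nat \<Rightarrow> 3 \<times> 3"
  have "bij_betw \<Phi> (plane4.tensors m) (funs_below ?n)"
  proof (rule bij_betwI[of _ _ _ \<Psi>])
    show "\<Phi> \<in> plane4.tensors m \<rightarrow> funs_below ?n"
      by (auto simp: \<Phi>_def funs_below_def)
    have "\<Psi> v x = 0" if "x \<notin> ?W" for v x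
    proof -
      have "x \<notin> Y" using that Y_W by blast
      with that show ?thesis unfolding \<Psi>_def by (simp only: if_False)
    qed
    then show "\<Psi> \<in> funs_below ?n \<rightarrow> plane4.tensors m"
      unfolding plane4.tensors_def by blast
    show "\<Psi> (\<Phi> f) = f" if f: "f \<in> plane4.tensors m" for f
    proof
      fix x
      consider "x \<in> Y" | "x \<in> ?W" "x \<notin> Y" | "x \<notin> ?W" by blast
      then show "\<Psi> (\<Phi> f) x = f x"
      proof cases
        case 1
        then show ?thesis
          using ee'[OF 1] by (simp add: \<Phi>_def \<Psi>_def mult.assoc[symmetric] ss)
      next
        case 2
        then have "co x \<in> Y" using co_Y by blast
        with 2 show ?thesis
          using ee'[OF \<open>co x \<in> Y\<close>] by (simp add: \<Phi>_def \<Psi>_def co_co)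
      next
        case 3
        with f Y_W show ?thesis by (auto simp: \<Psi>_def plane4.tensors_def)
      qed
    qed
    show "\<Phi> (\<Psi> v) = v" if v: "v \<in> funs_below ?n" for v
    proof
      fix k
      show "\<Phi> (\<Psi> v) k = v k"
      proof (cases "k < ?n")
        case True
        then have "co (e k) \<notin> Y" using co_Y eW eY by blast
        with True show ?thesis
          by (simp add: \<Phi>_def \<Psi>_def eY eW co_co e'e mult.assoc[symmetric] ss)
      qed (use v in \<open>simp add: \<Phi>_def funs_below_def\<close>)
    qed
  qed
  moreover have "sum_form form3 ?n (\<Phi> f) (\<Phi> g) = plane4.tensor_form m f g" for f g
  proof -
    let ?h = "\<lambda>x. f x * s x * g (co x)"
    have C: "plane4.C m x y = (if y = co x then s x else 0)" if y: "y \<in> ?W" for x y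
    proof (cases "y = co x")
      case False
      then obtain k where "k < m" "y k \<noteq> co x k"
        using words_eq_iff[OF y co_W] by blast
      then have "(\<Prod>k<m. alt2 (x k) (y k)) = 0"
        by (intro prod_zero bexI[of _ k]) (auto simp: co_def alt2_def)
      with False show ?thesis by (simp add: plane4.C_def)
    qed (simp add: s_def)
    have "plane4.tensor_form m f g = (\<Sum>x\<in>?W. \<Sum>y\<in>?W. if y = co x then f x * s x * g y else 0)"
      unfolding plane4.tensor_form_def by (intro sum.cong refl) (simp add: C)
    also have "\<dots> = sum ?h ?W"
      by (simp add: plane4.finite_words)
    also have "\<dots> = sum ?h (?W - Y) + sum ?h Y"
      by (rule sum.subset_diff[OF Y_W plane4.finite_words])
    also have "sum ?h (?W - Y) = (\<Sum>x\<in>Y. ?h (co x))"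
      using sum.reindex_bij_betw[OF bij_co, of ?h] by simp
    also have "(\<Sum>x\<in>Y. ?h (co x)) + sum ?h Y = (\<Sum>x\<in>Y. g (co x) * (s x * f x) - f (co x) * (s x * g x))"
      unfolding sum.distrib[symmetric] using Y_W
      by (intro sum.cong refl) (auto simp: s_co co_co algebra_simps subset_iff)
    also have "\<dots> = (\<Sum>k<?n. g (co (e k)) * (s (e k) * f (e k)) - f (co (e k)) * (s (e k) * g (e k)))"
      by (rule sum.reindex_bij_betw[OF e, symmetric])
    also have "\<dots> = sum_form form3 ?n (\<Phi> f) (\<Phi> g)"
      by (simp add: sum_form_def \<Phi>_def)
    finally show ?thesis by simp
  qed
  moreover have "\<Phi> (f + g) = \<Phi> f + \<Phi> g" "\<Phi> (\<lambda>x. - 1 * f x) = (\<lambda>k. - \<Phi> f k)" for f g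
    by (auto simp: \<Phi>_def fun_eq_iff algebra_simps)
  ultimately show ?thesis by blast
qed

text \<open>The Heisenberg model supplies \<open>\<phi>\<close>; the Weil action on tensors,
  commuting with the scalar \<open>\<omega>\<close>, supplies the invariant for
  \<open>G'\<close>.\<close>

lemma heis3_step:
  assumes G: "heis3_stage m G" and N: "group N" "N \<cong> heisenberg (funs_below m) (sum_form form3 m) psi3"
  shows "\<exists>G'. heis4_stage (3 ^ m) G' \<and>
    (\<exists>\<phi>\<in>mon G (AutoGroup N). G' \<cong> semidirect_product G \<phi> N)"
proof -
  let ?N = "heisenberg (funs_below m) (sum_form form3 m) psi3"
  from G obtain a where "group G" "finite (carrier G)"
    and a: "isometric_action G (funs_below m) (sum_form form3 m) (\<lambda>v k. - v k) a"
    by (auto simp: heis3_stage_def)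
  let ?\<alpha> = "\<lambda>g (v, c). (a g v, c)"
  let ?S = "semidirect_product G ?\<alpha> ?N"
  note \<alpha> = plane3.isometric_action_heisenberg[OF a]
  have S: "group ?S"
    by (rule semidirect_product_group[OF \<open>group G\<close> plane3.heisenberg_group \<alpha>(1)])
  have "finite (carrier ?S)"
    using \<open>finite (carrier G)\<close> plane3.heisenberg_finite[of m] by (simp del: heisenberg_simps)
  then obtain G' :: "nat monoid" where G': "group G'" "finite (carrier G')" "G' \<cong> ?S"
    using iso_nat_monoid[OF S] by blast
  obtain \<eta> where "\<eta> \<in> iso N ?N"
    using N(2) by (auto simp: is_iso_def)
  from acts_by_automorphisms_transfer[OF \<open>group G\<close> N(1) this \<alpha>]
  obtain \<phi> where \<phi>: "\<phi> \<in> mon G (AutoGroup N)" "?S \<cong> semidirect_product G \<phi> N"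
    by blast
  obtain \<Phi> where \<Phi>: "bij_betw \<Phi> (plane3.tensors m) (funs_below (3 ^ m))"
    "\<And>f g. \<Phi> (f + g) = \<Phi> f + \<Phi> g"
    "\<And>f g. sum_form form4 (3 ^ m) (\<Phi> f) (\<Phi> g) = plane3.tensor_form m f g"
    "\<And>f. \<Phi> (\<lambda>x. \<omega> * f x) = (\<lambda>k. \<omega> * \<Phi> f k)"
    using tensors3_isometry[of m] by blast
  have "\<exists>a. isometric_action ?S (funs_below (3 ^ m)) (sum_form form4 (3 ^ m)) (\<lambda>v k. \<omega> * v k) a"
    using isometric_action_transport[OF plane3.isometric_action_semidirect[OF \<open>group G\<close> a, of \<omega>] \<Phi>(1),
        where \<beta>' = "sum_form form4 (3 ^ m)" and \<tau>' = "\<lambda>v k. \<omega> * v k"]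
    by (auto simp: plane3.M_add plane3.M_scale \<Phi>)
  then have "heis4_stage (3 ^ m) G'"
    using isometric_action_iso[OF S G'(1,3)] G' by (auto simp: heis4_stage_def)
  moreover have "G' \<cong> semidirect_product G \<phi> N"
    using G'(3) \<phi>(2) by (rule iso_trans)
  ultimately show ?thesis
    using \<phi>(1) by blast
qed

lemma heis4_step:
  assumes G: "heis4_stage m G" and N: "group N" "N \<cong> heisenberg (funs_below m) (sum_form form4 m) psi4"
    and m: "odd m"
  shows "\<exists>G'. heis3_stage (2 ^ (m - 1)) G' \<and>
    (\<exists>\<phi>\<in>mon G (AutoGroup N). G' \<cong> semidirect_product G \<phi> N)"
proof -
  let ?N = "heisenberg (funs_below m) (sum_form form4 m) psi4"
  from G obtain a where "group G" "finite (carrier G)"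
    and a: "isometric_action G (funs_below m) (sum_form form4 m) (\<lambda>v k. \<omega> * v k) a"
    by (auto simp: heis4_stage_def)
  let ?\<alpha> = "\<lambda>g (v, c). (a g v, c)"
  let ?S = "semidirect_product G ?\<alpha> ?N"
  note \<alpha> = plane4.isometric_action_heisenberg[OF a]
  have S: "group ?S"
    by (rule semidirect_product_group[OF \<open>group G\<close> plane4.heisenberg_group \<alpha>(1)])
  have "finite (carrier ?S)"
    using \<open>finite (carrier G)\<close> plane4.heisenberg_finite[of m] by (simp del: heisenberg_simps)
  then obtain G' :: "nat monoid" where G': "group G'" "finite (carrier G')" "G' \<cong> ?S"
    using iso_nat_monoid[OF S] by blast
  obtain \<eta> where "\<eta> \<in> iso N ?N"
    using N(2) by (auto simp: is_iso_def)
  from acts_by_automorphisms_transfer[OF \<open>group G\<close> N(1) this \<alpha>]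
  obtain \<phi> where \<phi>: "\<phi> \<in> mon G (AutoGroup N)" "?S \<cong> semidirect_product G \<phi> N"
    by blast
  obtain \<Phi> where \<Phi>: "bij_betw \<Phi> (plane4.tensors m) (funs_below (2 ^ (m - 1)))"
    "\<And>f g. \<Phi> (f + g) = \<Phi> f + \<Phi> g"
    "\<And>f g. sum_form form3 (2 ^ (m - 1)) (\<Phi> f) (\<Phi> g) = plane4.tensor_form m f g"
    "\<And>f. \<Phi> (\<lambda>x. - 1 * f x) = (\<lambda>k. - \<Phi> f k)"
    using tensors4_isometry[OF m] by blast
  have "\<exists>a. isometric_action ?S (funs_below (2 ^ (m - 1))) (sum_form form3 (2 ^ (m - 1))) (\<lambda>v k. - v k) a"
    using isometric_action_transport[OF plane4.isometric_action_semidirect[OF \<open>group G\<close> a, of "- 1"] \<Phi>(1),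
        where \<beta>' = "sum_form form3 (2 ^ (m - 1))" and \<tau>' = "\<lambda>v k. - v k"]
      plane4.M_add plane4.M_scale[of _ m "- 1"] \<Phi>(2-4) by blast
  then have "heis3_stage (2 ^ (m - 1)) G'"
    using isometric_action_iso[OF S G'(1,3)] G' by (auto simp: heis3_stage_def)
  moreover have "G' \<cong> semidirect_product G \<phi> N"
    using G'(3) \<phi>(2) by (rule iso_trans)
  ultimately show ?thesis
    using \<phi>(1) by blast
qed

theorem mainTheorem1:
  fixes E Q :: "'a monoid" and m :: "nat \<Rightarrow> nat"
    and Ei :: "nat \<Rightarrow> (nat \<Rightarrow> 'a) set monoid"
  assumes "extraspecial 3 E" and "order E = 27" and "exponent E = 3"
    and "group Q" and "Q \<cong> quaternion_group"
    and "m 1 = 1"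
    and "\<And>k. k \<ge> 1 \<Longrightarrow> m (2 * k) = 3 ^ m (2 * k - 1)"
    and "\<And>k. k \<ge> 1 \<Longrightarrow> m (2 * k + 1) = 2 ^ (m (2 * k) - 1)"
    and "\<And>i. i \<ge> 1 \<Longrightarrow>
           Ei i = (if odd i then central_power E (m i) else central_power Q (m i))"
  shows "\<exists>G :: nat \<Rightarrow> nat monoid.
           (\<forall>i\<ge>1. group (G i)) \<and>
           G 1 \<cong> (Sp2 :: (3 ^ 2 ^ 2) monoid) \<and>
           (\<forall>i\<ge>1. \<exists>\<phi> \<in> mon (G i) (AutoGroup (Ei i)).
              G (i + 1) \<cong> semidirect_product (G i) \<phi> (Ei i))"
proof -
  have even_m: "m (Suc i) = 3 ^ m i" if "odd i" for i
    using assms(7)[of "(i + 1) div 2"] that by (auto elim!: oddE)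
  have odd_m: "m (Suc i) = 2 ^ (m i - 1)" if "even i" "0 < i" for i
    using assms(8)[of "i div 2"] that by (auto elim!: evenE)
  have pos: "0 < m i" if "0 < i" for i
  proof (cases "i = 1")
    case False
    then show ?thesis
      using that even_m[of "i - 1"] odd_m[of "i - 1"] by (cases "odd (i - 1)") auto
  qed (use assms(6) in simp)
  \<comment> \<open>Values at even indices are powers of 3, hence odd, as \<open>heis4_step\<close>
    requires.\<close>
  have odd: "odd (m i)" if "even i" "0 < i" for i
    using even_m[of "i - 1"] that by auto
  obtain \<theta> where "\<theta> \<in> iso E (heisenberg (UNIV :: (3 \<times> 3) set) form3 psi3)"
    using extraspecial_27_iso_heisenberg[OF assms(1-3)] by blast
  note E = plane3.central_power_iso[OF _ this]
  have "group E" using assms(1) by (simp add: extraspecial_def)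
  note E = E[OF this]
  obtain \<theta>1 \<theta>2 where "\<theta>1 \<in> iso Q quaternion_group"
    "\<theta>2 \<in> iso quaternion_group (heisenberg (UNIV :: gf4 set) form4 psi4)"
    using assms(5) quaternion_group_iso_heisenberg by (auto simp: is_iso_def)
  then have "\<theta>2 \<circ> \<theta>1 \<in> iso Q (heisenberg (UNIV :: gf4 set) form4 psi4)"
    by (rule iso_set_trans)
  note Q = plane4.central_power_iso[OF assms(4) this]
  define stage where "stage i G = (if odd i then heis3_stage (m i) G else heis4_stage (m i) G)" for i G
  have step: "\<exists>G'. stage (Suc i) G' \<and> (\<exists>\<phi>\<in>mon G (AutoGroup (Ei i)). G' \<cong> semidirect_product G \<phi> (Ei i))"
    if "stage i G" "0 < i" for i G
  proof (cases "odd i")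
    case True
    then have "Ei i = central_power E (m i)" using assms(9)[of i] that(2) by simp
    then show ?thesis
      using heis3_step[of "m i" G "Ei i"] E[OF pos[OF that(2)]] that(1) True even_m[OF True]
      by (simp add: stage_def)
  next
    case False
    then have "Ei i = central_power Q (m i)" using assms(9)[of i] that(2) by simp
    then show ?thesis
      using heis4_step[of "m i" G "Ei i"] Q[OF pos[OF that(2)]] that False odd_m[of i] odd[of i]
      by (simp add: stage_def)
  qed
  have "finite (carrier (Sp2 :: (3 ^ 2 ^ 2) monoid))"
    by (rule finite_subset[OF subset_UNIV]) simp
  from iso_nat_monoid[OF Sp2_group this]
  obtain G1 :: "nat monoid" where G1: "group G1" "finite (carrier G1)"
    "G1 \<cong> (Sp2 :: (3 ^ 2 ^ 2) monoid)" by blast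
  have m1: "m (Suc 0) = Suc 0" using assms(6) by simp
  have "stage 1 G1"
    using isometric_action_iso[OF Sp2_group G1(1,3)] Sp2_isometric_action G1(1,2)
    by (auto simp: stage_def heis3_stage_def m1)
  \<comment> \<open>Dependent choice starts at 0, so \<open>f n\<close> is the group with index
    \<open>n + 1\<close>.\<close>
  then have "\<exists>f. \<forall>n. (stage (Suc n) (f n) \<and> (n = 0 \<longrightarrow> f n \<cong> (Sp2 :: (3 ^ 2 ^ 2) monoid))) \<and>
      (\<exists>\<phi>\<in>mon (f n) (AutoGroup (Ei (Suc n))). f (Suc n) \<cong> semidirect_product (f n) \<phi> (Ei (Suc n)))"
    using step G1(3) by (intro dependent_nat_choice) auto
  then obtain f where f: "\<And>n. stage (Suc n) (f n)" "f 0 \<cong> (Sp2 :: (3 ^ 2 ^ 2) monoid)"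
    "\<And>n. \<exists>\<phi>\<in>mon (f n) (AutoGroup (Ei (Suc n))). f (Suc n) \<cong> semidirect_product (f n) \<phi> (Ei (Suc n))"
    by blast
  have "group (f n)" for n
    using f(1)[of n] by (auto simp: stage_def heis3_stage_def heis4_stage_def split: if_splits)
  moreover have "\<exists>\<phi>\<in>mon (f (i - 1)) (AutoGroup (Ei i)). f (i + 1 - 1) \<cong> semidirect_product (f (i - 1)) \<phi> (Ei i)"
    if "1 \<le> i" for i
    using f(3)[of "i - 1"] that by simp
  ultimately show ?thesis
    using f(2) by (intro exI[of _ "\<lambda>i. f (i - 1)"]) auto
qed

end
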